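(* For every fixed integer $h\ge1$, $$B_h(x)\ll_h\frac{x}{(\log x)^2}.$$
   Context: $\mathbb N=\{1,2,\ldots\}$; $\sigma(n)=\sum_{d\mid n}d$; $B_h(x)=\#\{n\in\mathbb N: n\le x,\ \sigma(n)\mid\sigma(n+h)\}$. The notation $f(x)\ll_h g(x)$ means $|f(x)|\le C_h\,g(x)$ for all sufficiently large $x$ (in terms of $h$), with $C_h$ depending only on $h$. *)

theory Defs
  imports Complex_Main "HOL-Library.Landau_Symbols"
begin

(* Only meaningful for n > 0: every number divides 0, so the sum over the infinite set is 0. *)
definition sigma :: "nat \<Rightarrow> nat" where
  "sigma n = (\<Sum>d | d dvd n. d)"

definition B :: "nat \<Rightarrow> real \<Rightarrow> nat" where
  "B h x = card {n :: nat. 1 \<le> n \<and> real n \<le> x \<and> sigma n dvd sigma (n + h)}"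

end

theory Submission
  imports Defs "HOL-Number_Theory.Number_Theory" "HOL-Analysis.Harmonic_Numbers" "HOL-Real_Asymp.Real_Asymp"
begin

text \<open>
  Rankin's trick shows that, outside a negligible set, \<open>n = a p\<close> with \<open>p\<close> a large prime not dividing \<open>a\<close>
  and \<open>p + 1\<close> divisible by a prime \<open>r > L\<close>, where \<open>L\<close> is a power of \<open>ln x\<close>. Then \<open>r\<close> divides
  \<open>sigma (n + h)\<close>, so (prime powers being rare) \<open>n + h = b q\<close> with \<open>q\<close> prime and \<open>r\<close> dividing \<open>q + 1\<close>.
  If \<open>p q\<close> is at most \<open>x sqrt r\<close>, count \<open>n\<close> modulo \<open>p q\<close>. Otherwise \<open>a b\<close> is small and
  \<open>a = b + h\<close> modulo \<open>r\<close>; if this is not an equality, count \<open>n\<close> modulo \<open>lcm (a r) b\<close>. Both counts save a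
  power of \<open>L\<close> after summing over \<open>r\<close>. In the remaining case \<open>a = b + h\<close> the equation becomes
  \<open>(b + h) (p + 1) = b (q + 1)\<close>, so \<open>p = \<alpha> t - 1\<close> and \<open>q = \<beta> t - 1\<close> with \<open>\<alpha>\<close>, \<open>\<beta>\<close> determined by \<open>b\<close>, and
  Selberg's sieve bounds the number of such \<open>t\<close> by \<open>x / (b sqrt b (ln x)\<^sup>2)\<close>. Only this case
  contributes \<open>x / (ln x)\<^sup>2\<close>; the others are smaller or can be made so.
\<close>

section \<open>Selberg's sieve\<close>

text \<open>Sums over the primes p and q are enlarged to sums over all integers congruent to -1
  modulo \<open>r\<close>, which costs powers of \<open>ln x\<close>. They are repaid by
  \<open>r\<close>: each count attached to a given \<open>r\<close> carries a factor at most
  r^(-3/2), so summing over r > L saves sqrt L, and L may be any fixed power of \<open>ln x\<close>.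
  Hence the search for one large prime \<open>r\<close> dividing both p + 1 and q + 1. The obstacle
  is a = b + h: the congruence modulo \<open>r\<close> is then an identity and \<open>r\<close>
  saves nothing. But p and q are then values of two linear forms at the same t, with t at most a
  constant times x / b^2, and the two primality conditions supply the two logarithms. The singular
  series is replaced by the square of one plus the number of prime factors of 2 \<alpha> \<beta>
  (\<beta> - \<alpha>). This is O(sqrt b), which leaves the convergent sum of b^(-3/2).\<close>

lemma sum_interval_neg_one_power_card:
  fixes U :: "'a set"
  assumes "finite U" "S \<subseteq> U"
  shows "(\<Sum>A | S \<subseteq> A \<and> A \<subseteq> U. (-1) ^ card A) = (if S = U then (-1) ^ card U else (0::real))"
proof (cases "S = U")
  case True
  then have "{A. S \<subseteq> A \<and> A \<subseteq> U} = {U}" by auto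
  then show ?thesis using True by simp
next
  case False
  have fin: "finite {A. S \<subseteq> A \<and> A \<subseteq> U}"
    using assms(1) by (rule_tac finite_subset[of _ "Pow U"]) auto
  have "S \<subset> U" using assms False by auto
  from card_subsupersets_even_odd[OF assms(1) this] have "(\<Sum>A | S \<subseteq> A \<and> A \<subseteq> U. (-1) ^ card A) = (0::real)"
    by (intro sum_alternating_cancels fin) (simp add: conj_ac)
  then show ?thesis using False by simp
qed

text \<open>A finite set \<open>A\<close> of primes stands for the squarefree integer \<open>\<Prod>A\<close>, so that the lcm and gcd of the usual
  formulation become union and intersection. In the proof, \<open>lam\<close> are Selberg's optimal weights, which diagonalise the
  quadratic form.\<close>

lemma selberg_sieve:
  fixes f :: "'a \<Rightarrow> real" and bad :: "'b \<Rightarrow> 'a set" and R :: "'a set \<Rightarrow> real"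
  assumes finP: "finite P" and f: "\<And>p. p \<in> P \<Longrightarrow> f p > 1" and finW: "finite W"
    and DP: "D \<subseteq> Pow P" and emp: "{} \<in> D" and down: "\<And>A B. A \<in> D \<Longrightarrow> B \<subseteq> A \<Longrightarrow> B \<in> D"
    and R: "\<And>A. A \<in> D \<Longrightarrow> R A \<ge> 0"
    and rem: "\<And>A B. A \<in> D \<Longrightarrow> B \<in> D \<Longrightarrow>
      \<bar>real (card {t \<in> W. A \<union> B \<subseteq> bad t}) - X / prod f (A \<union> B)\<bar> \<le> R A * R B"
  shows "real (card {t \<in> W. bad t \<inter> P = {}}) \<le>
    X / (\<Sum>A\<in>D. \<Prod>p\<in>A. 1 / (f p - 1)) + (\<Sum>A\<in>D. R A * (\<Prod>p\<in>A. f p / (f p - 1)))\<^sup>2"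
proof -
  define g where "g = (\<lambda>p. 1 / (f p - 1))"
  define G where "G = (\<Sum>A\<in>D. prod g A)"
  define lam where "lam = (\<lambda>A. (-1) ^ card A * prod f A * (\<Sum>S | S \<in> D \<and> A \<subseteq> S. prod g S) / G)"
  have finD: "finite D" using finite_subset[OF DP] finP by simp
  have fin: "finite A" if "A \<in> D" for A using that DP finP finite_subset by blast
  have gpos: "prod g A > 0" if "A \<in> D" for A
    using that DP f unfolding g_def by (intro prod_pos) auto
  have fpos: "prod f A > 0" if "A \<subseteq> P" for A
    using that f by (intro prod_pos) (force intro: less_trans[of 0 1])
  have Gpos: "G > 0"
    unfolding G_def using gpos finD emp by (intro sum_pos) auto
  have lam1: "lam {} = 1"
    unfolding lam_def using Gpos by (simp add: G_def)
  \<comment> \<open>The diagonalising variables of the quadratic form. By Moebius inversion in the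
    lattice of subsets, after exchanging the sums only U = S survives.\<close>
  have inner: "(\<Sum>A\<in>D. of_bool (S \<subseteq> A) * (lam A / prod f A)) = (-1) ^ card S * prod g S / G"
    if S: "S \<in> D" for S
  proof -
    have "(\<Sum>A\<in>D. of_bool (S \<subseteq> A) * (lam A / prod f A))
        = (\<Sum>A\<in>D. \<Sum>U\<in>D. of_bool (S \<subseteq> A \<and> A \<subseteq> U) * ((-1) ^ card A * prod g U / G))"
    proof (rule sum.cong[OF refl])
      fix A assume A: "A \<in> D"
      have "prod f A \<noteq> 0" using fpos[of A] A DP by auto
      then have "lam A / prod f A = (-1) ^ card A * (\<Sum>U | U \<in> D \<and> A \<subseteq> U. prod g U) / G"
        by (simp add: lam_def)
      also have "(\<Sum>U | U \<in> D \<and> A \<subseteq> U. prod g U) = (\<Sum>U\<in>D. of_bool (A \<subseteq> U) * prod g U)"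
        by (subst sum.inter_filter[OF finD]) (auto intro!: sum.cong)
      finally show "of_bool (S \<subseteq> A) * (lam A / prod f A)
        = (\<Sum>U\<in>D. of_bool (S \<subseteq> A \<and> A \<subseteq> U) * ((-1) ^ card A * prod g U / G))"
        by (simp add: sum_distrib_left sum_divide_distrib of_bool_conj mult_ac)
    qed
    also have "\<dots> = (\<Sum>U\<in>D. \<Sum>A\<in>D. of_bool (S \<subseteq> A \<and> A \<subseteq> U) * ((-1) ^ card A * prod g U / G))"
      by (rule sum.swap)
    also have "\<dots> = (\<Sum>U\<in>D. if U = S then (-1) ^ card S * prod g S / G else 0)"
    proof (rule sum.cong[OF refl])
      fix U assume U: "U \<in> D"
      have "(\<Sum>A\<in>D. of_bool (S \<subseteq> A \<and> A \<subseteq> U) * ((-1) ^ card A * prod g U / G))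
        = (\<Sum>A | A \<in> D \<and> (S \<subseteq> A \<and> A \<subseteq> U). (-1) ^ card A * prod g U / G)"
        by (subst sum.inter_filter[OF finD]) (auto intro!: sum.cong)
      also have "{A. A \<in> D \<and> (S \<subseteq> A \<and> A \<subseteq> U)} = {A. S \<subseteq> A \<and> A \<subseteq> U}"
        using down U by blast
      also have "(\<Sum>A | S \<subseteq> A \<and> A \<subseteq> U. (-1) ^ card A * prod g U / G)
        = (\<Sum>A | S \<subseteq> A \<and> A \<subseteq> U. (-1) ^ card A) * (prod g U / G)"
        by (simp add: sum_distrib_right sum_divide_distrib)
      also have "\<dots> = (if U = S then (-1) ^ card S * prod g S / G else 0)"
      proof (cases "S \<subseteq> U")
        case True
        then show ?thesis using sum_interval_neg_one_power_card[OF fin[OF U] True] by auto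
      next
        case False
        then have "{A. S \<subseteq> A \<and> A \<subseteq> U} = {}" by auto
        then show ?thesis using False by (auto simp del: Collect_empty_eq)
      qed
      finally show "(\<Sum>A\<in>D. of_bool (S \<subseteq> A \<and> A \<subseteq> U) * ((-1) ^ card A * prod g U / G))
        = (if U = S then (-1) ^ card S * prod g S / G else 0)" .
    qed
    also have "\<dots> = (-1) ^ card S * prod g S / G" using S finD by simp
    finally show ?thesis .
  qed
  \<comment> \<open>The union is removed by f(A \<union> B) f(A \<inter> B) = f(A) f(B). Expanding
    f(A \<inter> B) as the product of (f p - 1) + 1 then gives a sum over common subsets S, that is,
    a sum of squares of the variables in \<open>inner\<close>.\<close>
  have quad: "(\<Sum>A\<in>D. \<Sum>B\<in>D. lam A * lam B / prod f (A \<union> B)) = 1 / G"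
  proof -
    have "(\<Sum>A\<in>D. \<Sum>B\<in>D. lam A * lam B / prod f (A \<union> B))
      = (\<Sum>A\<in>D. \<Sum>B\<in>D. \<Sum>S\<in>D. (\<Prod>p\<in>S. f p - 1) *
          ((of_bool (S \<subseteq> A) * (lam A / prod f A)) * (of_bool (S \<subseteq> B) * (lam B / prod f B))))"
    proof (intro sum.cong refl)
      fix A B assume A: "A \<in> D" and B: "B \<in> D"
      have AP: "A \<subseteq> P" "B \<subseteq> P" using A B DP by auto
      have "prod f (A \<union> B) * prod f (A \<inter> B) = prod f A * prod f B"
        using fin A B by (intro prod.union_inter) auto
      moreover have "prod f (A \<inter> B) = (\<Sum>S\<in>D. of_bool (S \<subseteq> A) * of_bool (S \<subseteq> B) * (\<Prod>p\<in>S. f p - 1))"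
      proof -
        have "prod f (A \<inter> B) = (\<Prod>p\<in>A\<inter>B. (f p - 1) + 1)" by simp
        also have "\<dots> = (\<Sum>S\<in>Pow (A \<inter> B). \<Prod>p\<in>S. f p - 1)"
          using fin A by (subst prod_add) auto
        also have "Pow (A \<inter> B) = {S. S \<in> D \<and> (S \<subseteq> A \<and> S \<subseteq> B)}" using down A by blast
        also have "(\<Sum>S\<in>\<dots>. \<Prod>p\<in>S. f p - 1) = (\<Sum>S\<in>D. if S \<subseteq> A \<and> S \<subseteq> B then \<Prod>p\<in>S. f p - 1 else 0)"
          by (rule sum.inter_filter[OF finD])
        also have "\<dots> = (\<Sum>S\<in>D. of_bool (S \<subseteq> A) * of_bool (S \<subseteq> B) * (\<Prod>p\<in>S. f p - 1))"
          by (auto intro!: sum.cong)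
        finally show ?thesis .
      qed
      moreover have "prod f (A \<union> B) > 0" "prod f A > 0" "prod f B > 0"
        using fpos[of "A \<union> B"] fpos[of A] fpos[of B] AP by auto
      ultimately have "lam A * lam B / prod f (A \<union> B) = lam A / prod f A * (lam B / prod f B)
        * (\<Sum>S\<in>D. of_bool (S \<subseteq> A) * of_bool (S \<subseteq> B) * (\<Prod>p\<in>S. f p - 1))"
        by (simp add: field_simps)
      also have "\<dots> = (\<Sum>S\<in>D. (\<Prod>p\<in>S. f p - 1) *
          ((of_bool (S \<subseteq> A) * (lam A / prod f A)) * (of_bool (S \<subseteq> B) * (lam B / prod f B))))"
        by (subst sum_distrib_left) (simp add: mult_ac)
      finally show "lam A * lam B / prod f (A \<union> B) = \<dots>" .
    qed
    also have "\<dots> = (\<Sum>S\<in>D. (\<Prod>p\<in>S. f p - 1) * (\<Sum>A\<in>D. of_bool (S \<subseteq> A) * (lam A / prod f A))\<^sup>2)"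
    proof -
      have "(\<Sum>A\<in>D. \<Sum>B\<in>D. \<Sum>S\<in>D. F A B S) = (\<Sum>S\<in>D. \<Sum>A\<in>D. \<Sum>B\<in>D. F A B S)"
        for F :: "'a set \<Rightarrow> 'a set \<Rightarrow> 'a set \<Rightarrow> real"
        by (subst sum.swap[of "\<lambda>A S. \<Sum>B\<in>D. F A B S", symmetric]) (intro sum.cong refl sum.swap)
      then show ?thesis
        unfolding power2_eq_square sum_product by (simp only: sum_distrib_left)
    qed
    also have "\<dots> = (\<Sum>S\<in>D. prod g S / G\<^sup>2)"
    proof (intro sum.cong refl)
      fix S assume S: "S \<in> D"
      have "(\<Prod>p\<in>S. f p - 1) * prod g S = (\<Prod>p\<in>S. 1)"
        unfolding prod.distrib[symmetric] g_def using S DP f by (intro prod.cong) fastforce+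
      then have "(\<Prod>p\<in>S. f p - 1) * prod g S = 1" by simp
      then have "(\<Prod>p\<in>S. f p - 1) * (prod g S)\<^sup>2 = prod g S"
        unfolding power2_eq_square by (metis mult.assoc mult_1)
      then show "(\<Prod>p\<in>S. f p - 1) * (\<Sum>A\<in>D. of_bool (S \<subseteq> A) * (lam A / prod f A))\<^sup>2 = prod g S / G\<^sup>2"
        unfolding inner[OF S] by (simp add: power_divide power_mult_distrib flip: power_mult)
    qed
    also have "\<dots> = 1 / G"
      unfolding sum_divide_distrib[symmetric] G_def[symmetric] using Gpos by (simp add: power2_eq_square)
    finally show ?thesis .
  qed
  \<comment> \<open>The map S \<mapsto> S - A sends the sets of \<open>D\<close> containing A
    injectively into \<open>D\<close>, so the sum in \<open>lam A\<close> is at most g(A) G.\<close>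
  have lam_le: "\<bar>lam A\<bar> \<le> (\<Prod>p\<in>A. f p / (f p - 1))" if A: "A \<in> D" for A
  proof -
    have AP: "A \<subseteq> P" using A DP by auto
    have "(\<Sum>S | S \<in> D \<and> A \<subseteq> S. prod g S) = (\<Sum>S | S \<in> D \<and> A \<subseteq> S. prod g A * prod g (S - A))"
    proof (intro sum.cong refl)
      fix S assume "S \<in> {S. S \<in> D \<and> A \<subseteq> S}"
      then show "prod g S = prod g A * prod g (S - A)"
        using fin by (subst prod.subset_diff[of A S]) (auto simp: mult.commute)
    qed
    also have "\<dots> = prod g A * (\<Sum>S | S \<in> D \<and> A \<subseteq> S. prod g (S - A))" by (simp add: sum_distrib_left)
    also have "(\<Sum>S | S \<in> D \<and> A \<subseteq> S. prod g (S - A)) = sum (prod g) ((\<lambda>S. S - A) ` {S. S \<in> D \<and> A \<subseteq> S})"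
      by (subst sum.reindex) (auto simp: inj_on_def)
    also have "\<dots> \<le> G"
      unfolding G_def using down gpos by (intro sum_mono2 finD) (auto intro: less_imp_le)
    finally have 1: "(\<Sum>S | S \<in> D \<and> A \<subseteq> S. prod g S) \<le> prod g A * G"
      using gpos[OF A] by simp
    have "0 \<le> (\<Sum>S | S \<in> D \<and> A \<subseteq> S. prod g S)" using gpos by (intro sum_nonneg) (auto intro: less_imp_le)
    then have "\<bar>lam A\<bar> = prod f A * (\<Sum>S | S \<in> D \<and> A \<subseteq> S. prod g S) / G"
      unfolding lam_def using fpos[OF AP] Gpos by (simp add: abs_mult)
    also have "\<dots> \<le> prod f A * (prod g A * G) / G"
      using 1 fpos[OF AP] Gpos by (intro divide_right_mono mult_left_mono) auto
    also have "\<dots> = (\<Prod>p\<in>A. f p / (f p - 1))"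
      using Gpos by (simp add: g_def prod.distrib[symmetric])
    finally show ?thesis .
  qed
  have "real (card {t \<in> W. bad t \<inter> P = {}}) = (\<Sum>t\<in>W. if bad t \<inter> P = {} then 1 else 0)"
    by (simp add: sum.inter_filter[OF finW, symmetric])
  \<comment> \<open>Selberg's majorant: a square is never negative, and for an unsifted t only A =
    {} contributes, with \<open>lam {}\<close> = 1.\<close>
  also have "\<dots> \<le> (\<Sum>t\<in>W. (\<Sum>A\<in>D. of_bool (A \<subseteq> bad t) * lam A)\<^sup>2)"
  proof (rule sum_mono)
    fix t assume "t \<in> W"
    have "(\<Sum>A\<in>D. of_bool (A \<subseteq> bad t) * lam A) = 1" if "bad t \<inter> P = {}"
    proof -
      have "(\<Sum>A\<in>D. of_bool (A \<subseteq> bad t) * lam A) = (\<Sum>A\<in>D. if A = {} then lam {} else 0)"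
        using that DP by (intro sum.cong) auto
      then show ?thesis using emp finD lam1 by simp
    qed
    then show "(if bad t \<inter> P = {} then 1 else 0) \<le> (\<Sum>A\<in>D. of_bool (A \<subseteq> bad t) * lam A)\<^sup>2" by auto
  qed
  also have "\<dots> = (\<Sum>A\<in>D. \<Sum>B\<in>D. lam A * lam B * real (card {t \<in> W. A \<union> B \<subseteq> bad t}))"
  proof -
    have "(\<Sum>t\<in>W. (\<Sum>A\<in>D. of_bool (A \<subseteq> bad t) * lam A)\<^sup>2)
       = (\<Sum>t\<in>W. \<Sum>A\<in>D. \<Sum>B\<in>D. lam A * lam B * (if A \<union> B \<subseteq> bad t then 1 else 0))"
      unfolding power2_eq_square sum_product by (intro sum.cong refl) auto
    also have "\<dots> = (\<Sum>A\<in>D. \<Sum>B\<in>D. \<Sum>t\<in>W. lam A * lam B * (if A \<union> B \<subseteq> bad t then 1 else 0))"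
      by (subst sum.swap) (intro sum.cong refl sum.swap)
    also have "\<dots> = (\<Sum>A\<in>D. \<Sum>B\<in>D. lam A * lam B * real (card {t \<in> W. A \<union> B \<subseteq> bad t}))"
      by (simp add: sum.inter_filter[OF finW, symmetric] sum_distrib_left[symmetric] del: Un_subset_iff)
    finally show ?thesis .
  qed
  \<comment> \<open>Because the remainder is assumed bounded by a product R A * R B, its double sum
    factors into a square.\<close>
  also have "\<dots> \<le> (\<Sum>A\<in>D. \<Sum>B\<in>D. X * (lam A * lam B / prod f (A \<union> B)) +
      (R A * (\<Prod>p\<in>A. f p / (f p - 1))) * (R B * (\<Prod>p\<in>B. f p / (f p - 1))))"
  proof (intro sum_mono)
    fix A B assume A: "A \<in> D" and B: "B \<in> D"
    define c where "c = real (card {t \<in> W. A \<union> B \<subseteq> bad t})"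
    define e where "e = c - X / prod f (A \<union> B)"
    have "lam A * lam B * c = X * (lam A * lam B / prod f (A \<union> B)) + lam A * lam B * e"
      unfolding e_def by (simp add: algebra_simps)
    also have "lam A * lam B * e \<le> \<bar>lam A\<bar> * \<bar>lam B\<bar> * \<bar>e\<bar>"
      by (metis abs_ge_self abs_mult)
    also have "\<dots> \<le> ((\<Prod>p\<in>A. f p / (f p - 1)) * (\<Prod>p\<in>B. f p / (f p - 1))) * (R A * R B)"
      using rem[OF A B] lam_le[OF A] lam_le[OF B]
      by (intro mult_mono) (auto simp: e_def c_def intro: order_trans[OF abs_ge_zero] simp del: Un_subset_iff)
    finally show "lam A * lam B * c \<le> X * (lam A * lam B / prod f (A \<union> B)) +
      (R A * (\<Prod>p\<in>A. f p / (f p - 1))) * (R B * (\<Prod>p\<in>B. f p / (f p - 1)))"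
      by (simp add: mult_ac)
  qed
  also have "\<dots> = X * (1 / G) + (\<Sum>A\<in>D. R A * (\<Prod>p\<in>A. f p / (f p - 1)))\<^sup>2"
    unfolding sum.distrib sum_distrib_left[symmetric] quad power2_eq_square sum_product ..
  finally show ?thesis by (simp add: G_def g_def)
qed

section \<open>Sums over integers with prescribed prime factors\<close>

lemma sum_power_le_geometric:
  fixes x :: real
  assumes "finite K" "0 \<le> x" "x < 1" "\<And>k. k \<in> K \<Longrightarrow> 1 \<le> k"
  shows "(\<Sum>k\<in>K. x ^ k) \<le> x / (1 - x)"
proof -
  define n where "n = Max (insert 0 K)"
  have "K \<subseteq> {1..n}" using assms by (auto simp: n_def)
  then have "(\<Sum>k\<in>K. x ^ k) \<le> (\<Sum>k\<in>{1..n}. x ^ k)"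
    using assms by (intro sum_mono2) auto
  also have "\<dots> = (\<Sum>k<n. x * x ^ k)"
    by (rule sum.reindex_bij_witness[of _ Suc "\<lambda>k. k - 1"]) (auto simp flip: power_Suc)
  also have "\<dots> = x * ((1 - x ^ n) / (1 - x))"
    using assms by (simp add: sum_distrib_left[symmetric] sum_gp_strict)
  also have "\<dots> \<le> x * (1 / (1 - x))"
    using assms by (intro mult_left_mono divide_right_mono) auto
  finally show ?thesis by simp
qed

text \<open>The integers with prime set exactly B correspond to vectors of exponents that are all at
  least 1, so each p contributes at most w p + (w p)^2 + ... = w p / (1 - w p). Restricting to a
  finite set N keeps every sum finite; N varies in the induction because dividing out the p-part
  moves the integers to another finite set.\<close>

lemma sum_prime_factors_eq_le:
  fixes w :: "nat \<Rightarrow> real" and B :: "nat set"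
  assumes mult: "\<And>m n. w (m * n) = w m * w n" and one: "w 1 = 1" and nonneg: "\<And>n. w n \<ge> 0"
    and "finite B" and "\<And>p. p \<in> B \<Longrightarrow> prime p \<and> w p < 1" and "finite N"
  shows "(\<Sum>n | n \<in> N \<and> n > 0 \<and> prime_factors n = B. w n) \<le> (\<Prod>p\<in>B. w p / (1 - w p))"
  using assms(4-6)
proof (induction B arbitrary: N rule: finite_induct)
  case empty
  have "{n. n \<in> N \<and> n > 0 \<and> prime_factors n = {}} \<subseteq> {1}"
    by (auto simp: prime_factorization_empty_iff)
  then have "(\<Sum>n | n \<in> N \<and> n > 0 \<and> prime_factors n = {}. w n) \<le> (\<Sum>n\<in>{1}. w n)"
    using nonneg by (intro sum_mono2) auto
  then show ?case using one by simp
next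
  case (insert p B)
  define S where "S = {n. n \<in> N \<and> n > 0 \<and> prime_factors n = insert p B}"
  define \<phi> where "\<phi> = (\<lambda>n. (multiplicity p n, n div p ^ multiplicity p n))"
  have p: "prime p" "w p < 1" and B: "\<And>q. q \<in> B \<Longrightarrow> prime q \<and> w q < 1" using insert.prems by auto
  have finS: "finite S" using insert.prems by (simp add: S_def)
  have wpow: "w (q ^ k) = w q ^ k" for q k by (induction k) (use one mult in auto)
  have dec: "n = p ^ multiplicity p n * (n div p ^ multiplicity p n)" for n
    by (simp add: multiplicity_dvd)
  have inj: "inj_on \<phi> S"
    by (rule inj_onI) (metis \<phi>_def dec prod.inject)
  define N' where "N' = (\<lambda>n. n div p ^ multiplicity p n) ` S"
  have sub: "\<phi> ` S \<subseteq> multiplicity p ` S \<times> {m. m \<in> N' \<and> m > 0 \<and> prime_factors m = B}"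
  proof (rule image_subsetI)
    fix n assume n: "n \<in> S"
    define k where "k = multiplicity p n"
    define m where "m = n div p ^ k"
    have nm: "n = p ^ k * m" using dec[of n] by (simp add: k_def m_def)
    have n0: "n > 0" "prime_factors n = insert p B" using n by (auto simp: S_def)
    have pB: "p \<in> prime_factors n" using n0 by simp
    then have k: "k > 0" unfolding k_def by (simp add: prime_factors_multiplicity)
    have m0: "m > 0" using nm n0 by (cases "m = 0") auto
    have pm: "\<not> p dvd m"
      unfolding m_def k_def using n0 p by (intro multiplicity_decompose) (auto simp: prime_gt_1_nat)
    have "prime_factors n = insert p (prime_factors m)"
      unfolding nm using m0 p k by (subst prime_factors_product) (auto simp: prime_factors_power prime_prime_factors)
    then have "prime_factors m = B" using n0 pm insert.hyps
      by (metis Diff_insert_absorb in_prime_factors_iff)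
    moreover have "m \<in> N'" unfolding N'_def m_def k_def using n by blast
    ultimately show "\<phi> n \<in> multiplicity p ` S \<times> {m. m \<in> N' \<and> m > 0 \<and> prime_factors m = B}"
      using n m0 unfolding \<phi>_def m_def k_def by simp
  qed
  have "(\<Sum>n\<in>S. w n) = (\<Sum>n\<in>S. (\<lambda>(k, m). w p ^ k * w m) (\<phi> n))"
  proof (rule sum.cong[OF refl])
    fix n
    have "w n = w (p ^ multiplicity p n * (n div p ^ multiplicity p n))" using dec[of n] by simp
    then show "w n = (\<lambda>(k, m). w p ^ k * w m) (\<phi> n)" by (simp only: \<phi>_def mult wpow prod.case)
  qed
  also have "\<dots> = (\<Sum>(k, m)\<in>\<phi> ` S. w p ^ k * w m)"
    using inj by (simp add: sum.reindex o_def)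
  also have "\<dots> \<le> (\<Sum>(k, m)\<in>multiplicity p ` S \<times> {m. m \<in> N' \<and> m > 0 \<and> prime_factors m = B}. w p ^ k * w m)"
    using sub finS nonneg by (intro sum_mono2) (auto simp: N'_def)
  also have "\<dots> = (\<Sum>k\<in>multiplicity p ` S. w p ^ k) * (\<Sum>m | m \<in> N' \<and> m > 0 \<and> prime_factors m = B. w m)"
    by (simp add: sum_product sum.cartesian_product)
  also have "\<dots> \<le> (w p / (1 - w p)) * (\<Prod>p\<in>B. w p / (1 - w p))"
  proof (intro mult_mono)
    show "(\<Sum>k\<in>multiplicity p ` S. w p ^ k) \<le> w p / (1 - w p)"
    proof (rule sum_power_le_geometric)
      fix k assume "k \<in> multiplicity p ` S"
      then obtain n where n: "n \<in> S" "k = multiplicity p n" by auto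
      then have "p \<in> prime_factors n" by (auto simp: S_def)
      then show "1 \<le> k" using n by (simp add: prime_factors_multiplicity)
    qed (use finS nonneg p in auto)
    show "(\<Sum>m | m \<in> N' \<and> m > 0 \<and> prime_factors m = B. w m) \<le> (\<Prod>p\<in>B. w p / (1 - w p))"
      using B finS by (intro insert.IH) (auto simp: N'_def)
  qed (use nonneg p in \<open>auto intro!: sum_nonneg\<close>)
  also have "\<dots> = (\<Prod>p\<in>insert p B. w p / (1 - w p))" using insert.hyps by simp
  finally show ?case by (simp add: S_def)
qed

text \<open>Partial Euler product: group the integers by their exact set of prime factors and use 1
  + w / (1 - w) = 1 / (1 - w).\<close>

lemma sum_smooth_le:
  fixes w :: "nat \<Rightarrow> real"
  assumes mult: "\<And>m n. w (m * n) = w m * w n" and one: "w 1 = 1" and nonneg: "\<And>n. w n \<ge> 0"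
    and finP: "finite P" and P: "\<And>p. p \<in> P \<Longrightarrow> prime p \<and> w p < 1" and finN: "finite N"
  shows "(\<Sum>n | n \<in> N \<and> n > 0 \<and> prime_factors n \<subseteq> P. w n) \<le> (\<Prod>p\<in>P. 1 / (1 - w p))"
proof -
  have "(\<Sum>n | n \<in> N \<and> n > 0 \<and> prime_factors n \<subseteq> P. w n)
      = (\<Sum>B\<in>Pow P. \<Sum>n | n \<in> {n. n \<in> N \<and> n > 0 \<and> prime_factors n \<subseteq> P} \<and> prime_factors n = B. w n)"
    using finN finP by (intro sum.group[symmetric]) auto
  also have "\<dots> \<le> (\<Sum>B\<in>Pow P. \<Prod>p\<in>B. w p / (1 - w p))"
  proof (rule sum_mono)
    fix B assume B: "B \<in> Pow P"
    have "{n. n \<in> {n. n \<in> N \<and> n > 0 \<and> prime_factors n \<subseteq> P} \<and> prime_factors n = B}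
      = {n. n \<in> N \<and> n > 0 \<and> prime_factors n = B}" using B by auto
    moreover have "(\<Sum>n | n \<in> N \<and> n > 0 \<and> prime_factors n = B. w n) \<le> (\<Prod>p\<in>B. w p / (1 - w p))"
      using B P finP finite_subset by (intro sum_prime_factors_eq_le mult one nonneg finN) auto
    ultimately show "(\<Sum>n | n \<in> {n. n \<in> N \<and> n > 0 \<and> prime_factors n \<subseteq> P} \<and> prime_factors n = B. w n)
      \<le> (\<Prod>p\<in>B. w p / (1 - w p))" by simp
  qed
  also have "\<dots> = (\<Prod>p\<in>P. w p / (1 - w p) + 1)"
    using finP by (subst prod_add) auto
  also have "\<dots> = (\<Prod>p\<in>P. 1 / (1 - w p))"
  proof (rule prod.cong[OF refl])
    fix p assume "p \<in> P"
    then have "1 - w p \<noteq> 0" using P by fastforce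
    then show "w p / (1 - w p) + 1 = 1 / (1 - w p)" by (simp add: field_simps)
  qed
  finally show ?thesis .
qed

lemma prime_factors_prod_primes:
  assumes "finite A" "\<And>p. p \<in> A \<Longrightarrow> prime (p::nat)"
  shows "prime_factors (\<Prod>A) = A"
  using assms
proof (induction A rule: finite_induct)
  case (insert p A)
  have "\<Prod>A \<noteq> 0" using insert.hyps insert.prems[of 0] by auto
  moreover have "p \<noteq> 0" using insert.prems[of p] by auto
  ultimately show ?case using insert
    by (simp add: prime_factors_product prime_prime_factors)
qed auto

lemma two_power_card_le_prod:
  assumes "finite A" "\<And>p. p \<in> A \<Longrightarrow> 2 \<le> (p::nat)"
  shows "2 ^ card A \<le> \<Prod>A"
  using assms
proof (induction A rule: finite_induct)
  case (insert p A)
  then have "2 * 2 ^ card A \<le> p * \<Prod>A" by (intro mult_mono) auto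
  then show ?case using insert by simp
qed auto

text \<open>Group the n \<le> U by their set of prime factors B, whose product divides n and so is
  at most U. The integers with this B contribute at most the product of 1 / (p - 1). This is the
  source of the logarithms in the sieve bound.\<close>

lemma harm_le_sum_squarefree:
  "harm U \<le> (\<Sum>B | B \<subseteq> {p. prime p \<and> p \<le> U} \<and> \<Prod>B \<le> U. \<Prod>p\<in>B. 1 / (real p - 1))"
proof -
  let ?D = "{B. B \<subseteq> {p. prime p \<and> p \<le> U} \<and> \<Prod>B \<le> U}"
  have finD: "finite ?D" by (rule finite_subset[of _ "Pow {..U}"]) auto
  have "harm U = (\<Sum>n\<in>{1..U}. 1 / real n)"
    by (simp add: harm_def divide_inverse)
  also have "\<dots> = (\<Sum>B\<in>?D. \<Sum>n | n \<in> {1..U} \<and> prime_factors n = B. 1 / real n)"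
  proof (rule sum.group[symmetric])
    show "prime_factors ` {1..U} \<subseteq> ?D"
    proof (rule image_subsetI)
      fix n assume n: "n \<in> {1..U}"
      have "\<Prod>(prime_factors n) dvd (\<Prod>p\<in>prime_factors n. p ^ multiplicity p n)"
        by (rule prod_dvd_prod) (auto simp: prime_factors_multiplicity)
      also have "\<dots> = n" using n by (simp add: prod_prime_factors)
      finally have "\<Prod>(prime_factors n) \<le> n" using n by (intro dvd_imp_le) auto
      then have "\<Prod>(prime_factors n) \<le> U" using n by simp
      moreover have "prime_factors n \<subseteq> {p. prime p \<and> p \<le> U}"
        using n by (auto simp: in_prime_factors_iff intro: order_trans[OF dvd_imp_le])
      ultimately show "prime_factors n \<in> ?D" by auto
    qed
  qed (use finD in auto)
  also have "\<dots> \<le> (\<Sum>B\<in>?D. \<Prod>p\<in>B. 1 / (real p - 1))"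
  proof (rule sum_mono)
    fix B assume B: "B \<in> ?D"
    have "finite B" using B by (auto intro: finite_subset[of _ "{..U}"])
    have gt1: "prime p \<and> 1 / real p < 1" if "p \<in> B" for p
      using B that prime_gt_1_nat[of p] by (auto simp: divide_simps)
    have "(\<Sum>n | n \<in> {1..U} \<and> prime_factors n = B. 1 / real n)
      = (\<Sum>n | n \<in> {1..U} \<and> n > 0 \<and> prime_factors n = B. 1 / real n)"
      by (rule sum.cong) auto
    also have "\<dots> \<le> (\<Prod>p\<in>B. (1 / real p) / (1 - 1 / real p))"
      using \<open>finite B\<close> gt1 by (intro sum_prime_factors_eq_le) auto
    also have "\<dots> = (\<Prod>p\<in>B. 1 / (real p - 1))"
    proof (rule prod.cong[OF refl])
      fix p assume "p \<in> B"
      then have "p > 1" using B prime_gt_1_nat[of p] by auto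
      then show "(1 / real p) / (1 - 1 / real p) = 1 / (real p - 1)" by (simp add: field_simps)
    qed
    finally show "(\<Sum>n | n \<in> {1..U} \<and> prime_factors n = B. 1 / real n) \<le> (\<Prod>p\<in>B. 1 / (real p - 1))" .
  qed
  finally show ?thesis .
qed

text \<open>The \<open>i\<close>-th smallest element is at least \<open>i + 1\<close>, so the product is dominated by a telescoping one.\<close>

lemma prod_ratio_le_card:
  assumes "finite A" "\<And>p. p \<in> A \<Longrightarrow> 2 \<le> (p::nat)"
  shows "(\<Prod>p\<in>A. real p / (real p - 1)) \<le> real (card A) + 1"
  using assms
proof (induction "card A" arbitrary: A)
  case (Suc k)
  define m where "m = Max A"
  have "A \<noteq> {}" using Suc by auto
  then have m: "m \<in> A" using Suc by (simp add: m_def)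
  have "A \<subseteq> {2..m}" using Suc.prems by (auto simp: m_def)
  then have "card A \<le> m - 1" using card_mono[of "{2..m}" A] by simp
  then have k: "k + 2 \<le> m" using Suc by simp
  have card: "card (A - {m}) = k" using Suc m by (metis card_Diff_singleton diff_Suc_1)
  have "(\<Prod>p\<in>A - {m}. real p / (real p - 1)) \<le> real k + 1"
    using Suc(1)[of "A - {m}"] Suc.prems card by auto
  moreover have "real m / (real m - 1) \<le> (real k + 2) / (real k + 1)"
    using k by (simp add: field_simps)
  ultimately have "real m / (real m - 1) * (\<Prod>p\<in>A - {m}. real p / (real p - 1))
    \<le> (real k + 2) / (real k + 1) * (real k + 1)"
    using Suc.prems k by (intro mult_mono prod_nonneg) fastforce+
  moreover have "(real k + 2) / (real k + 1) * (real k + 1) = real (card A) + 1"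
    using Suc(2) by (simp flip: Suc(2))
  ultimately show ?case
    using prod.remove[OF Suc.prems(1) m, of "\<lambda>p. real p / (real p - 1)"] by simp
qed auto

text \<open>Splitting B into its primes dividing Q and the others, the former contribute at most the
  product of p / (p - 1) over p | Q. Bounding that product by the number of primes plus one yields a
  factor that depends only on how many primes divide Q.\<close>

lemma sum_coprime_squarefree_ge:
  assumes Q: "Q > 0" and U: "U > 0"
  shows "ln (real U) \<le> (real (card (prime_factors Q)) + 1) *
    (\<Sum>A | A \<subseteq> {p. prime p \<and> p \<le> U \<and> \<not> p dvd Q} \<and> \<Prod>A \<le> U. \<Prod>p\<in>A. 1 / (real p - 1))"
proof -
  define w where "w = (\<lambda>A. \<Prod>p\<in>A. 1 / (real p - 1))"
  define Z where "Z = prime_factors Q"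
  let ?D = "{B. B \<subseteq> {p. prime p \<and> p \<le> U} \<and> \<Prod>B \<le> U}"
  let ?E = "{A. A \<subseteq> {p. prime p \<and> p \<le> U \<and> \<not> p dvd Q} \<and> \<Prod>A \<le> U}"
  have finD: "finite ?D" by (rule finite_subset[of _ "Pow {..U}"]) auto
  have finE: "finite ?E" by (rule finite_subset[of _ "Pow {..U}"]) auto
  have Zp: "\<And>p. p \<in> Z \<Longrightarrow> prime p" by (auto simp: Z_def)
  have wnn: "w A \<ge> 0" if "\<And>p. p \<in> A \<Longrightarrow> prime p" for A
    unfolding w_def using that prime_ge_1_nat by (intro prod_nonneg) force
  have finB: "finite B" if "B \<in> ?D" for B using that by (auto intro: finite_subset[of _ "{..U}"])
  have "ln (real U) \<le> ln (real U + 1)" using U by simp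
  also have "\<dots> \<le> harm U" by (rule harm_ge_ln)
  also have "\<dots> \<le> (\<Sum>B\<in>?D. w B)" unfolding w_def by (rule harm_le_sum_squarefree)
  also have "\<dots> = (\<Sum>B\<in>?D. (\<lambda>(B1, B2). w B1 * w B2) (B \<inter> Z, B - Z))"
    unfolding w_def using finB by (intro sum.cong refl) (simp add: prod.Int_Diff)
  also have "\<dots> = (\<Sum>(B1, B2)\<in>(\<lambda>B. (B \<inter> Z, B - Z)) ` ?D. w B1 * w B2)"
    by (subst sum.reindex) (auto simp: inj_on_def)
  also have "\<dots> \<le> (\<Sum>(B1, B2)\<in>Pow Z \<times> ?E. w B1 * w B2)"
  proof (rule sum_mono2)
    show "(\<lambda>B. (B \<inter> Z, B - Z)) ` ?D \<subseteq> Pow Z \<times> ?E"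
    proof (rule image_subsetI)
      fix B assume B: "B \<in> ?D"
      have "\<Prod>(B - Z) dvd \<Prod>B" using finB[OF B] by (intro prod_dvd_prod_subset) auto
      moreover have "\<Prod>B > 0" using B by (auto simp: prime_gt_0_nat intro!: prod_pos)
      ultimately have "\<Prod>(B - Z) \<le> \<Prod>B" by (rule dvd_imp_le)
      then have "\<Prod>(B - Z) \<le> U" using B by simp
      moreover have "B - Z \<subseteq> {p. prime p \<and> p \<le> U \<and> \<not> p dvd Q}"
        using B Q by (auto simp: Z_def in_prime_factors_iff)
      ultimately show "(B \<inter> Z, B - Z) \<in> Pow Z \<times> ?E" by auto
    qed
    show "finite (Pow Z \<times> ?E)" using finE by (simp add: Z_def)
    fix b assume "b \<in> Pow Z \<times> ?E - (\<lambda>B. (B \<inter> Z, B - Z)) ` ?D"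
    then obtain B1 B2 where b: "b = (B1, B2)" "B1 \<subseteq> Z" "B2 \<in> ?E" by blast
    have "w B1 \<ge> 0" using b Zp by (intro wnn) auto
    moreover have "w B2 \<ge> 0" using b by (intro wnn) auto
    ultimately show "0 \<le> (case b of (B1, B2) \<Rightarrow> w B1 * w B2)" using b by simp
  qed
  also have "\<dots> = (\<Sum>B1\<in>Pow Z. w B1) * (\<Sum>B2\<in>?E. w B2)"
    by (simp add: sum_product sum.cartesian_product)
  also have "(\<Sum>B1\<in>Pow Z. w B1) = (\<Prod>p\<in>Z. 1 / (real p - 1) + 1)"
    by (subst prod_add) (auto simp: Z_def w_def)
  also have "\<dots> = (\<Prod>p\<in>Z. real p / (real p - 1))"
  proof (rule prod.cong[OF refl])
    fix p assume "p \<in> Z"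
    then have "p > 1" using Zp prime_gt_1_nat by blast
    then show "1 / (real p - 1) + 1 = real p / (real p - 1)" by (simp add: field_simps)
  qed
  also have "(\<Prod>p\<in>Z. real p / (real p - 1)) * (\<Sum>B2\<in>?E. w B2) \<le> (real (card Z) + 1) * (\<Sum>B2\<in>?E. w B2)"
    using Zp prime_ge_2_nat by (intro mult_right_mono prod_ratio_le_card sum_nonneg wnn) (auto simp: Z_def)
  finally show ?thesis by (simp add: w_def Z_def)
qed

text \<open>Each p in C lies in A only, in B only, or in both, contributing w p, w p and (w p)^2.
  The proof encodes the pair as A together with A \<inter> B.\<close>

lemma sum_union_eq_prod:
  fixes w :: "'a \<Rightarrow> real"
  assumes "finite C"
  shows "(\<Sum>(A, B) | A \<subseteq> C \<and> B \<subseteq> C \<and> A \<union> B = C. prod w A * prod w B) = (\<Prod>p\<in>C. 2 * w p + (w p)\<^sup>2)"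
proof -
  have "(\<Sum>(A, B) | A \<subseteq> C \<and> B \<subseteq> C \<and> A \<union> B = C. prod w A * prod w B)
    = (\<Sum>(A, E)\<in>Sigma (Pow C) Pow. prod w A * (prod w (C - A) * prod w E))"
  proof (rule sum.reindex_bij_witness[of _ "\<lambda>(A, E). (A, (C - A) \<union> E)" "\<lambda>(A, B). (A, B \<inter> A)"])
    fix a assume a: "a \<in> {(A, B). A \<subseteq> C \<and> B \<subseteq> C \<and> A \<union> B = C}"
    obtain A B where ab: "a = (A, B)" by (cases a)
    have "B = (C - A) \<union> (B \<inter> A)" using a ab by auto
    then have "prod w B = prod w (C - A) * prod w (B \<inter> A)"
      using assms a ab finite_subset by (subst prod.union_disjoint[symmetric]) auto
    then show "(case (case a of (A, B) \<Rightarrow> (A, B \<inter> A)) of (A, E) \<Rightarrow> prod w A * (prod w (C - A) * prod w E))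
      = (case a of (A, B) \<Rightarrow> prod w A * prod w B)" by (simp add: ab)
  qed auto
  also have "\<dots> = (\<Sum>A\<in>Pow C. \<Sum>E\<in>Pow A. prod w A * (prod w (C - A) * prod w E))"
    using assms by (subst sum.Sigma) (auto dest: finite_subset)
  also have "\<dots> = (\<Sum>A\<in>Pow C. (\<Prod>p\<in>A. w p * (1 + w p)) * (\<Prod>p\<in>C - A. w p))"
  proof (rule sum.cong[OF refl])
    fix A assume "A \<in> Pow C"
    then have "finite A" using assms finite_subset by auto
    then have "(\<Sum>E\<in>Pow A. prod w E) = (\<Prod>p\<in>A. w p + 1)" by (subst prod_add) auto
    then show "(\<Sum>E\<in>Pow A. prod w A * (prod w (C - A) * prod w E))
      = (\<Prod>p\<in>A. w p * (1 + w p)) * (\<Prod>p\<in>C - A. w p)"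
      by (simp add: sum_distrib_left[symmetric] prod.distrib add.commute)
  qed
  also have "\<dots> = (\<Prod>p\<in>C. w p * (1 + w p) + w p)" using assms by (rule prod_add[symmetric])
  also have "\<dots> = (\<Prod>p\<in>C. 2 * w p + (w p)\<^sup>2)"
    by (simp add: algebra_simps power2_eq_square)
  finally show ?thesis .
qed

text \<open>Passes from a sieve removing one class per prime to one removing two. Multiply out the
  square and collect the pairs by their union; each prime then has weight 2 / (p - 1) + 1 / (p -
  1)^2, at most 2 / (p - 2) = 1 / (p / 2 - 1). A logarithmic lower bound for the simple sum thus
  becomes a squared logarithm for the sum needed here.\<close>

lemma square_sum_squarefree_le:
  assumes P: "finite P" "\<And>p. p \<in> P \<Longrightarrow> 3 \<le> (p::nat)"
  shows "(\<Sum>A | A \<subseteq> P \<and> \<Prod>A \<le> U. \<Prod>p\<in>A. 1 / (real p - 1))\<^sup>2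
    \<le> (\<Sum>A | A \<subseteq> P \<and> \<Prod>A \<le> U * U. \<Prod>p\<in>A. 1 / (real p / 2 - 1))"
proof -
  define w where "w = (\<lambda>p::nat. 1 / (real p - 1))"
  let ?D = "{A. A \<subseteq> P \<and> \<Prod>A \<le> U}" and ?E = "{A. A \<subseteq> P \<and> \<Prod>A \<le> U * U}"
  have fin: "finite ?D" "finite ?E" using P by (auto intro: finite_subset[of _ "Pow P"])
  have wnn: "prod w A \<ge> 0" if "A \<subseteq> P" for A
    using that P unfolding w_def by (intro prod_nonneg) fastforce
  have "(\<Sum>A\<in>?D. prod w A)\<^sup>2 = (\<Sum>(A, B)\<in>?D \<times> ?D. prod w A * prod w B)"
    by (simp add: power2_eq_square sum_product sum.cartesian_product)
  also have "\<dots> = (\<Sum>C\<in>?E. \<Sum>x | x \<in> ?D \<times> ?D \<and> (\<lambda>(A, B). A \<union> B) x = C. (\<lambda>(A, B). prod w A * prod w B) x)"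
  proof (rule sum.group[symmetric])
    show "(\<lambda>(A, B). A \<union> B) ` (?D \<times> ?D) \<subseteq> ?E"
    proof (rule image_subsetI, clarify)
      fix A B assume A: "A \<subseteq> P" "B \<subseteq> P" and le: "\<Prod>A \<le> U" "\<Prod>B \<le> U"
      have f: "finite A" "finite B" using A P(1) by (auto intro: finite_subset)
      have "\<Prod>(A \<inter> B) \<ge> 1" using A P by (intro prod_ge_1) force
      moreover have "\<Prod>(A \<union> B) * \<Prod>(A \<inter> B) = \<Prod>A * \<Prod>B" using f by (rule prod.union_inter)
      ultimately have "\<Prod>(A \<union> B) \<le> \<Prod>A * \<Prod>B" by (metis mult_le_mono2 nat_mult_1_right)
      also have "\<dots> \<le> U * U" using le by (intro mult_mono) auto
      finally show "A \<union> B \<subseteq> P \<and> \<Prod>(A \<union> B) \<le> U * U" using A by auto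
    qed
  qed (use fin in auto)
  also have "\<dots> \<le> (\<Sum>C\<in>?E. \<Prod>p\<in>C. 1 / (real p / 2 - 1))"
  proof (rule sum_mono)
    fix C assume C: "C \<in> ?E"
    have finC: "finite C" using C P(1) by (auto intro: finite_subset)
    have "(\<Sum>x | x \<in> ?D \<times> ?D \<and> (\<lambda>(A, B). A \<union> B) x = C. (\<lambda>(A, B). prod w A * prod w B) x)
      \<le> (\<Sum>x | (\<lambda>(A, B). A \<subseteq> C \<and> B \<subseteq> C \<and> A \<union> B = C) x. (\<lambda>(A, B). prod w A * prod w B) x)"
    proof (rule sum_mono2)
      show "finite {x. (\<lambda>(A, B). A \<subseteq> C \<and> B \<subseteq> C \<and> A \<union> B = C) x}"
        by (rule finite_subset[of _ "Pow C \<times> Pow C"]) (use finC in auto)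
    qed (use C wnn in \<open>auto intro!: mult_nonneg_nonneg\<close>)
    also have "\<dots> = (\<Prod>p\<in>C. 2 * w p + (w p)\<^sup>2)"
      using sum_union_eq_prod[OF finC, of w] by (simp add: case_prod_unfold)
    also have "\<dots> \<le> (\<Prod>p\<in>C. 1 / (real p / 2 - 1))"
    proof (rule prod_mono, intro conjI)
      fix p assume "p \<in> C"
      then have p: "real p \<ge> 3" using C P(2)[of p] by auto
      show "0 \<le> 2 * w p + (w p)\<^sup>2" using p by (auto simp: w_def)
      define a where "a = real p - 1"
      have a: "a \<ge> 2" "w p = 1 / a" using p by (auto simp: a_def w_def)
      have "2 * w p + (w p)\<^sup>2 = (2 * a + 1) / a\<^sup>2"
        unfolding a(2) using a(1) by (simp add: field_simps power2_eq_square)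
      also have "\<dots> \<le> 2 / (a - 1)"
        using a(1) by (simp add: field_simps power2_eq_square)
      also have "\<dots> = 1 / (real p / 2 - 1)" using p by (simp add: a_def field_simps)
      finally show "2 * w p + (w p)\<^sup>2 \<le> 1 / (real p / 2 - 1)" .
    qed
    finally show "(\<Sum>x | x \<in> ?D \<times> ?D \<and> (\<lambda>(A, B). A \<union> B) x = C. (\<lambda>(A, B). prod w A * prod w B) x)
       \<le> (\<Prod>p\<in>C. 1 / (real p / 2 - 1))" .
  qed
  finally show ?thesis by (simp add: w_def)
qed

section \<open>Prime pairs\<close>

text \<open>Congruence is required between elements of S rather than to a named residue, so that
  counts modulo a product or an lcm need no solution of simultaneous congruences.\<close>

lemma card_pairwise_cong_le:
  fixes S :: "nat set"
  assumes "m > 0" "\<And>n. n \<in> S \<Longrightarrow> n \<le> N" "\<And>n n'. n \<in> S \<Longrightarrow> n' \<in> S \<Longrightarrow> [n = n'] (mod m)"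
  shows "card S \<le> N div m + 1"
proof -
  have "inj_on (\<lambda>n. n div m) S"
  proof (rule inj_onI)
    fix n n' assume "n \<in> S" "n' \<in> S" "n div m = n' div m"
    moreover from this have "n mod m = n' mod m" using assms(3)[of n n'] by (simp add: Cong.cong_def)
    ultimately show "n = n'" by (metis div_mult_mod_eq)
  qed
  moreover have "(\<lambda>n. n div m) ` S \<subseteq> {..N div m}" using assms(2) by (auto intro: div_le_mono)
  ultimately have "card S \<le> card {..N div m}" by (rule card_inj_on_le) simp
  then show ?thesis by simp
qed

lemma real_div_bounds:
  fixes m N :: nat
  assumes "m > 0"
  shows "real (N div m) \<le> real N / real m" "real N / real m \<le> real (N div m) + 1"
proof -
  have "real N = real m * real (N div m) + real (N mod m)"
    by (metis mult_div_mod_eq of_nat_add of_nat_mult)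
  moreover have "real (N mod m) < real m" using assms by simp
  ultimately show "real (N div m) \<le> real N / real m" "real N / real m \<le> real (N div m) + 1"
    using assms by (auto simp: field_simps)
qed

lemma card_cong_class:
  fixes m N c :: nat
  assumes "m > 0"
  shows "\<bar>real (card {t \<in> {1..N}. [t = c] (mod m)}) - real N / real m\<bar> \<le> 1"
proof -
  let ?S = "{t \<in> {1..N}. [t = c] (mod m)}"
  have "card ?S \<le> N div m + 1"
    using assms by (intro card_pairwise_cong_le) (auto intro: cong_trans cong_sym)
  then have "real (card ?S) \<le> real (N div m) + 1" by linarith
  also have "\<dots> \<le> real N / real m + 1" using real_div_bounds(1)[OF assms] by simp
  finally have 1: "real (card ?S) \<le> real N / real m + 1" .
  \<comment> \<open>The representative is taken in {1..m}, because the counted interval starts at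
    1.\<close>
  define c0 where "c0 = (if c mod m = 0 then m else c mod m)"
  have c0: "1 \<le> c0" "c0 \<le> m" "[c0 = c] (mod m)"
    using assms by (auto simp: c0_def Cong.cong_def intro: less_imp_le)
  have "card {..<N div m} \<le> card ?S"
  proof (rule card_inj_on_le)
    show "inj_on (\<lambda>j. j * m + c0) {..<N div m}" using assms by (auto simp: inj_on_def)
    show "(\<lambda>j. j * m + c0) ` {..<N div m} \<subseteq> ?S"
    proof (rule image_subsetI)
      fix j assume "j \<in> {..<N div m}"
      then have "(j + 1) * m \<le> N div m * m" by (intro mult_right_mono) auto
      also have "\<dots> \<le> N" by simp
      finally have "j * m + c0 \<le> N" using c0 by (simp add: algebra_simps)
      moreover have "[j * m + c0 = c] (mod m)" using c0 by (simp add: Cong.cong_def)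
      ultimately show "j * m + c0 \<in> ?S" using c0 by auto
    qed
  qed simp
  moreover have "real N / real m \<le> real (N div m) + 1"
    using real_div_bounds(2)[OF assms] by simp
  ultimately show ?thesis using 1 by simp
qed

text \<open>By the Chinese remainder theorem each new prime splits a class modulo M into two
  disjoint classes modulo M p, so main term and error follow by doubling. The condition modulo M
  carries the induction; the sieve takes M = 1.\<close>

lemma card_two_residues:
  fixes A :: "nat set" and u v :: "nat \<Rightarrow> nat"
  assumes "finite A" and "\<And>p. p \<in> A \<Longrightarrow> prime p" and "\<And>p. p \<in> A \<Longrightarrow> \<not> [u p = v p] (mod p)"
    and "M > 0" and "\<And>p. p \<in> A \<Longrightarrow> coprime M p"
  shows "\<bar>real (card {t \<in> {1..N}. [t = c] (mod M) \<and> (\<forall>p\<in>A. [t = u p] (mod p) \<or> [t = v p] (mod p))})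
    - 2 ^ card A * real N / (real M * real (\<Prod>A))\<bar> \<le> 2 ^ card A"
  using assms
proof (induction A arbitrary: M c rule: finite_induct)
  case empty
  then show ?case using card_cong_class[of M N c] by simp
next
  case (insert p A)
  let ?R = "\<lambda>t. \<forall>p\<in>A. [t = u p] (mod p) \<or> [t = v p] (mod p)"
  have p: "prime p" "coprime M p" using insert.prems by auto
  have "p > 0" using p prime_gt_0_nat by auto
  have copA: "coprime (M * p) q" if "q \<in> A" for q
    using that insert.prems insert.hyps primes_coprime[of p q] by auto
  have IH: "\<bar>real (card {t \<in> {1..N}. [t = x] (mod (M * p)) \<and> ?R t})
    - 2 ^ card A * real N / (real (M * p) * real (\<Prod>A))\<bar> \<le> 2 ^ card A" for x
    using insert.prems \<open>p > 0\<close> copA by (intro insert.IH) auto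
  have crt: "\<exists>x. \<forall>t. [t = x] (mod (M * p)) \<longleftrightarrow> [t = c] (mod M) \<and> [t = y] (mod p)" for y
  proof -
    obtain x where x: "[x = c] (mod M)" "[x = y] (mod p)"
      using binary_chinese_remainder_nat[OF p(2)] by blast
    have "[t = x] (mod (M * p)) \<longleftrightarrow> [t = c] (mod M) \<and> [t = y] (mod p)" for t
      using x p(2) by (metis cong_modulus_mult_nat cong_sym cong_trans coprime_cong_mult_nat mult.commute)
    then show ?thesis by blast
  qed
  obtain x where x: "\<And>t. [t = x] (mod (M * p)) \<longleftrightarrow> [t = c] (mod M) \<and> [t = u p] (mod p)" using crt by blast
  obtain y where y: "\<And>t. [t = y] (mod (M * p)) \<longleftrightarrow> [t = c] (mod M) \<and> [t = v p] (mod p)" using crt by blast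
  have "{t \<in> {1..N}. [t = c] (mod M) \<and> (\<forall>p\<in>insert p A. [t = u p] (mod p) \<or> [t = v p] (mod p))}
    = {t \<in> {1..N}. [t = x] (mod (M * p)) \<and> ?R t} \<union> {t \<in> {1..N}. [t = y] (mod (M * p)) \<and> ?R t}"
    unfolding x y by auto
  moreover have "{t \<in> {1..N}. [t = x] (mod (M * p)) \<and> ?R t} \<inter> {t \<in> {1..N}. [t = y] (mod (M * p)) \<and> ?R t} = {}"
    unfolding x y using insert.prems(2)[of p] by (auto dest: cong_trans[OF cong_sym])
  ultimately have "real (card {t \<in> {1..N}. [t = c] (mod M) \<and>
        (\<forall>p\<in>insert p A. [t = u p] (mod p) \<or> [t = v p] (mod p))})
    = real (card {t \<in> {1..N}. [t = x] (mod (M * p)) \<and> ?R t})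
    + real (card {t \<in> {1..N}. [t = y] (mod (M * p)) \<and> ?R t})"
    by (simp add: card_Un_disjoint)
  moreover have "2 ^ card (insert p A) * real N / (real M * real (\<Prod>(insert p A)))
    = 2 * (2 ^ card A * real N / (real (M * p) * real (\<Prod>A)))"
    using insert.hyps by (simp add: mult_ac)
  moreover have "(2::real) ^ card (insert p A) = 2 ^ card A + 2 ^ card A"
    using insert.hyps by simp
  ultimately show ?case using IH[of x] IH[of y] by linarith
qed

text \<open>By unique factorisation a set of primes is determined by its product.\<close>

lemma card_prod_le:
  assumes "finite P" "\<And>p. p \<in> P \<Longrightarrow> prime (p::nat)"
  shows "card {A. A \<subseteq> P \<and> \<Prod>A \<le> D} \<le> D"
proof -
  have "card {A. A \<subseteq> P \<and> \<Prod>A \<le> D} \<le> card {1..D}"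
  proof (rule card_inj_on_le[of Prod])
    show "inj_on Prod {A. A \<subseteq> P \<and> \<Prod>A \<le> D}"
      using assms by (intro inj_onI) (metis (mono_tags, lifting) finite_subset mem_Collect_eq prime_factors_prod_primes subset_iff)
    show "Prod ` {A. A \<subseteq> P \<and> \<Prod>A \<le> D} \<subseteq> {1..D}"
    proof (rule image_subsetI)
      fix A assume A: "A \<in> {A. A \<subseteq> P \<and> \<Prod>A \<le> D}"
      then have "1 \<le> \<Prod>A" using assms(2) prime_ge_1_nat by (intro prod_ge_1) auto
      then show "\<Prod>A \<in> {1..D}" using A by auto
    qed
  qed simp
  then show ?thesis by simp
qed

text \<open>For a prime p not dividing Q, the congruences \<alpha> t = 1 and \<beta> t = 1 have one
  root each and the roots differ, so the sieve removes two classes modulo p and f p = p / 2. The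
  factor 2 in Q excludes p = 2, where f p > 1 fails. The number of prime factors of Q enters through
  the primes at which one cannot sieve.\<close>

lemma card_prime_pairs_le:
  fixes \<alpha> \<beta> N U :: nat
  assumes "\<alpha> > 0" "\<alpha> < \<beta>" "U \<ge> 2"
  defines "Q \<equiv> 2 * \<alpha> * \<beta> * (\<beta> - \<alpha>)"
  shows "real (card {t \<in> {1..N}. prime (\<alpha> * t - 1) \<and> prime (\<beta> * t - 1)})
    \<le> real N * (real (card (prime_factors Q)) + 1)\<^sup>2 / (ln (real U))\<^sup>2 + real U ^ 12 + real U + 1"
proof -
  define P where "P = {p. prime p \<and> p \<le> U \<and> \<not> p dvd Q}"
  define bad where "bad = (\<lambda>t. {p. [\<alpha> * t = 1] (mod p) \<or> [\<beta> * t = 1] (mod p)})"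
  \<comment> \<open>The level is U * U because the denominator is bounded below by the square of a
    sum over products up to U.\<close>
  define D where "D = {A. A \<subseteq> P \<and> \<Prod>A \<le> U * U}"
  define k where "k = real (card (prime_factors Q))"
  define R where "R = (\<lambda>A::nat set. 2 ^ card A :: real)"
  have Q0: "Q > 0" using assms by (simp add: Q_def)
  have finP: "finite P" by (rule finite_subset[of _ "{..U}"]) (auto simp: P_def)
  have Pp: "prime p" if "p \<in> P" for p using that by (simp add: P_def)
  have P3: "p \<ge> 3" if "p \<in> P" for p
  proof -
    have "p \<noteq> 2" using that by (auto simp: P_def Q_def)
    then show ?thesis using prime_ge_2_nat[OF Pp[OF that]] by simp
  qed
  have "\<exists>u. [\<alpha> * u = 1] (mod p)" "\<exists>u. [\<beta> * u = 1] (mod p)" if "p \<in> P" for p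
  proof -
    have "\<not> p dvd \<alpha>" "\<not> p dvd \<beta>" using that by (auto simp: P_def Q_def)
    then have "coprime \<alpha> p" "coprime \<beta> p"
      using prime_imp_coprime[OF Pp[OF that]] coprime_commute by blast+
    then show "\<exists>u. [\<alpha> * u = 1] (mod p)" "\<exists>u. [\<beta> * u = 1] (mod p)"
      using cong_solve_coprime_nat by auto
  qed
  then obtain u v where uv: "\<And>p. p \<in> P \<Longrightarrow> [\<alpha> * u p = 1] (mod p)" "\<And>p. p \<in> P \<Longrightarrow> [\<beta> * v p = 1] (mod p)"
    by metis
  have inv: "[a * t = 1] (mod p) \<longleftrightarrow> [t = w] (mod p)" if "[a * w = 1] (mod p)" for a t w p :: nat
  proof
    assume "[a * t = 1] (mod p)"
    then have "[w * (a * t) = w * 1] (mod p)" by (rule cong_scalar_left)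
    moreover have "[(a * w) * t = 1 * t] (mod p)" using that by (rule cong_scalar_right)
    ultimately show "[t = w] (mod p)"
      by (metis cong_sym cong_trans mult.assoc mult.commute mult_1)
  next
    assume "[t = w] (mod p)"
    then show "[a * t = 1] (mod p)" using that by (metis cong_scalar_left cong_trans)
  qed
  have ne: "\<not> [u p = v p] (mod p)" if p: "p \<in> P" for p
  proof
    assume "[u p = v p] (mod p)"
    then have "[\<beta> * u p = 1] (mod p)" using inv uv p by blast
    then have "[(\<beta> - \<alpha>) * u p + \<alpha> * u p = 0 + \<alpha> * u p] (mod p)"
      using uv(1)[OF p] assms(2) by (simp add: algebra_simps diff_mult_distrib) (metis cong_sym cong_trans)
    then have "p dvd (\<beta> - \<alpha>) * u p"
      using cong_add_rcancel_nat cong_0_iff by blast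
    moreover have "\<not> p dvd \<beta> - \<alpha>" using p by (auto simp: P_def Q_def)
    ultimately have "p dvd u p" using Pp[OF p] prime_dvd_mult_iff by blast
    then have "[\<alpha> * u p = 0] (mod p)" by (simp add: cong_0_iff)
    then have "[1 = 0] (mod p)" using uv(1)[OF p] cong_sym cong_trans by blast
    then show False using P3[OF p] by (simp add: Cong.cong_def)
  qed
  have DA: "finite A" "\<And>p. p \<in> A \<Longrightarrow> p \<in> P" "\<Prod>A \<le> U * U" if "A \<in> D" for A
    using that finP finite_subset by (auto simp: D_def)
  have main: "real (card {t \<in> {1..N}. bad t \<inter> P = {}}) \<le>
    real N / (\<Sum>A\<in>D. \<Prod>p\<in>A. 1 / (real p / 2 - 1))
    + (\<Sum>A\<in>D. R A * (\<Prod>p\<in>A. (real p / 2) / (real p / 2 - 1)))\<^sup>2"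
  proof (rule selberg_sieve[OF finP])
    fix p assume "p \<in> P" then show "real p / 2 > 1" using P3[of p] by auto
  next
    fix A B assume A: "A \<in> D" and AB: "B \<subseteq> A"
    have "\<Prod>B dvd \<Prod>A" using DA[OF A] AB by (intro prod_dvd_prod_subset) auto
    moreover have "\<Prod>A > 0" using DA(2)[OF A] P3 by (intro prod_pos) fastforce
    ultimately have "\<Prod>B \<le> \<Prod>A" by (rule dvd_imp_le)
    then show "B \<in> D" using A AB by (auto simp: D_def)
  next
    fix A B assume A: "A \<in> D" and B: "B \<in> D"
    define C where "C = A \<union> B"
    have C: "finite C" "\<And>p. p \<in> C \<Longrightarrow> p \<in> P" using DA A B by (auto simp: C_def)
    have "{t \<in> {1..N}. C \<subseteq> bad t}
      = {t \<in> {1..N}. [t = 0] (mod 1) \<and> (\<forall>p\<in>C. [t = u p] (mod p) \<or> [t = v p] (mod p))}"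
      using inv[OF uv(1)] inv[OF uv(2)] C(2) by (auto simp: bad_def subset_iff)
    moreover have "(\<Prod>p\<in>C. real p / 2) = real (\<Prod>C) / 2 ^ card C"
      by (simp add: prod_dividef)
    ultimately have "\<bar>real (card {t \<in> {1..N}. C \<subseteq> bad t}) - real N / (\<Prod>p\<in>C. real p / 2)\<bar> \<le> 2 ^ card C"
      using card_two_residues[of C u v 1 N 0] C ne Pp by (simp add: mult.commute)
    also have "(2::real) ^ card C \<le> 2 ^ (card A + card B)"
      unfolding C_def by (intro power_increasing card_Un_le) auto
    finally show "\<bar>real (card {t \<in> {1..N}. A \<union> B \<subseteq> bad t}) - real N / (\<Prod>p\<in>A \<union> B. real p / 2)\<bar> \<le> R A * R B"
      by (simp add: C_def R_def power_add)
  qed (use assms in \<open>auto simp: D_def R_def\<close>)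
  \<comment> \<open>Both 2 ^ card A and the product of p / (p - 2) are at most the product of A,
    hence at most U^2. With at most U^2 sets the sum is at most U^6, and the sieve squares it to
    U^12.\<close>
  have "(\<Sum>A\<in>D. R A * (\<Prod>p\<in>A. (real p / 2) / (real p / 2 - 1))) \<le> (\<Sum>A\<in>D. real U ^ 4)"
  proof (rule sum_mono)
    fix A assume A: "A \<in> D"
    have "(2::real) ^ card A = real (2 ^ card A)" by simp
    also have "2 ^ card A \<le> \<Prod>A" using DA[OF A] P3 by (intro two_power_card_le_prod) force+
    also have "\<Prod>A \<le> U * U" using DA[OF A] by simp
    finally have 1: "R A \<le> real (U * U)" by (simp add: R_def)
    have "(\<Prod>p\<in>A. (real p / 2) / (real p / 2 - 1)) \<le> (\<Prod>p\<in>A. real p)"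
    proof (rule prod_mono)
      fix p assume "p \<in> A"
      then have "real p \<ge> 3" using DA(2)[OF A] P3 by force
      then show "0 \<le> (real p / 2) / (real p / 2 - 1) \<and> (real p / 2) / (real p / 2 - 1) \<le> real p"
        by (simp add: field_simps)
    qed
    also have "\<dots> \<le> real (U * U)" using DA(3)[OF A] by (simp only: of_nat_prod[symmetric] of_nat_le_iff)
    finally have 2: "(\<Prod>p\<in>A. (real p / 2) / (real p / 2 - 1)) \<le> real (U * U)" .
    have "R A * (\<Prod>p\<in>A. (real p / 2) / (real p / 2 - 1)) \<le> real (U * U) * real (U * U)"
    proof (intro mult_mono 1 2 prod_nonneg)
      fix p assume "p \<in> A"
      then have "real p \<ge> 3" using DA(2)[OF A] P3 by force
      then show "0 \<le> (real p / 2) / (real p / 2 - 1)" by simp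
    qed auto
    then show "R A * (\<Prod>p\<in>A. (real p / 2) / (real p / 2 - 1)) \<le> real U ^ 4"
      by (simp add: eval_nat_numeral mult_ac)
  qed
  also have "\<dots> = real (card D) * real U ^ 4" by simp
  also have "\<dots> \<le> real (U * U) * real U ^ 4"
    using card_prod_le[OF finP Pp, of "U * U"] by (intro mult_right_mono) (auto simp: D_def simp del: of_nat_mult)
  also have "\<dots> = real U ^ 6" by (simp add: eval_nat_numeral mult_ac)
  finally have err0: "(\<Sum>A\<in>D. R A * (\<Prod>p\<in>A. (real p / 2) / (real p / 2 - 1))) \<le> real U ^ 6" .
  have "0 \<le> (\<Sum>A\<in>D. R A * (\<Prod>p\<in>A. (real p / 2) / (real p / 2 - 1)))"
  proof (intro sum_nonneg mult_nonneg_nonneg prod_nonneg)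
    fix A p assume "A \<in> D" "p \<in> A"
    then have "real p \<ge> 3" using DA(2) P3 by force
    then show "0 \<le> (real p / 2) / (real p / 2 - 1)" by simp
  qed (auto simp: R_def)
  then have err: "(\<Sum>A\<in>D. R A * (\<Prod>p\<in>A. (real p / 2) / (real p / 2 - 1)))\<^sup>2 \<le> real U ^ 12"
    using power_mono[OF err0, of 2] by (simp flip: power_mult)
  define G where "G = (\<Sum>A\<in>D. \<Prod>p\<in>A. 1 / (real p / 2 - 1))"
  define H where "H = (\<Sum>A | A \<subseteq> P \<and> \<Prod>A \<le> U. \<Prod>p\<in>A. 1 / (real p - 1))"
  have GH: "H\<^sup>2 \<le> G" unfolding G_def H_def D_def using finP P3 by (rule square_sum_squarefree_le)
  have lnH: "ln (real U) \<le> (k + 1) * H"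
    unfolding H_def k_def P_def using Q0 assms by (intro sum_coprime_squarefree_ge) auto
  have lnU: "ln (real U) > 0" using assms by simp
  have k0: "k \<ge> 0" by (simp add: k_def)
  have "(ln (real U))\<^sup>2 \<le> ((k + 1) * H)\<^sup>2" using lnH lnU by (intro power_mono) auto
  also have "\<dots> \<le> (k + 1)\<^sup>2 * G" using GH by (simp add: power_mult_distrib mult_left_mono)
  finally have lnG: "(ln (real U))\<^sup>2 \<le> (k + 1)\<^sup>2 * G" .
  have "0 < (k + 1)\<^sup>2 * G" using lnU by (intro less_le_trans[OF _ lnG]) simp
  then have "G > 0" using k0 by (simp add: zero_less_mult_iff)
  have "real N / G \<le> real N * (k + 1)\<^sup>2 / (ln (real U))\<^sup>2"
  proof -
    have "real N * (ln (real U))\<^sup>2 \<le> real N * ((k + 1)\<^sup>2 * G)" using lnG by (rule mult_left_mono) simp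
    then show ?thesis using \<open>G > 0\<close> lnU by (simp add: field_simps)
  qed
  then have main': "real (card {t \<in> {1..N}. bad t \<inter> P = {}}) \<le> real N * (k + 1)\<^sup>2 / (ln (real U))\<^sup>2 + real U ^ 12"
    using main err unfolding G_def[symmetric] by linarith
  \<comment> \<open>A prime value \<alpha> t - 1 divisible by a sifting prime equals that prime,
    which is at most U; this is possible only for t \<le> U + 1. The same holds for \<beta>.\<close>
  have "{t \<in> {1..N}. prime (\<alpha> * t - 1) \<and> prime (\<beta> * t - 1)} \<subseteq> {t \<in> {1..N}. bad t \<inter> P = {}} \<union> {1..U + 1}"
  proof
    fix t assume t: "t \<in> {t \<in> {1..N}. prime (\<alpha> * t - 1) \<and> prime (\<beta> * t - 1)}"
    have no: False if "U + 1 < t" "p \<in> P" "a > 0" "prime (a * t - 1)" "[a * t = 1] (mod p)" for p a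
    proof -
      have "t \<le> a * t" using that by simp
      have "[1 = a * t] (mod p)" using that by (simp add: cong_sym)
      then have "p dvd a * t - 1" using that \<open>t \<le> a * t\<close> by (simp add: cong_altdef_nat)
      then have "p = a * t - 1" using that Pp primes_dvd_imp_eq by blast
      moreover have "p \<le> U" using that by (simp add: P_def)
      ultimately show False using that \<open>t \<le> a * t\<close> by simp
    qed
    show "t \<in> {t \<in> {1..N}. bad t \<inter> P = {}} \<union> {1..U + 1}"
    proof (cases "t \<le> U + 1")
      case True then show ?thesis using t by auto
    next
      case False
      then show ?thesis using t no[of _ \<alpha>] no[of _ \<beta>] assms by (auto simp: bad_def)
    qed
  qed
  then have "card {t \<in> {1..N}. prime (\<alpha> * t - 1) \<and> prime (\<beta> * t - 1)}
    \<le> card ({t \<in> {1..N}. bad t \<inter> P = {}} \<union> {1..U + 1})"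
    by (intro card_mono) auto
  also have "\<dots> \<le> card {t \<in> {1..N}. bad t \<inter> P = {}} + card {1..U + 1}" by (rule card_Un_le)
  finally show ?thesis using main' by (simp add: k_def)
qed

section \<open>Smooth integers and sums of reciprocals\<close>

lemma harm_le_ln:
  assumes "n > 0"
  shows "harm n \<le> 1 + ln (real n)"
  using euler_mascheroni_sequence_decreasing[of 1 n] assms by (simp add: harm_expand)

text \<open>Rankin's trick with exponent \<open>\<delta> = 1 / ln y\<close>, chosen so that \<open>p powr \<delta> \<le> exp 1\<close> for \<open>p \<le> y\<close>. Replacing the sum
  over primes by one over all integers avoids Mertens' theorem at the cost of the factor \<open>y ^ 12\<close>.\<close>

lemma sum_smooth_tail_le:
  fixes y z :: real
  assumes "finite S" "z > 0" and y0: "y > 1" and "ln y \<ge> 2" and "\<And>n. n \<in> S \<Longrightarrow> z \<le> real n"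
    "\<And>n p. n \<in> S \<Longrightarrow> prime p \<Longrightarrow> p dvd n \<Longrightarrow> real p \<le> y"
  shows "(\<Sum>n\<in>S. 1 / real n) \<le> exp (- ln z / ln y + 12 * ln y)"
proof -
  define \<delta> where "\<delta> = 1 / ln y"
  define w where "w = (\<lambda>n::nat. real n powr (\<delta> - 1))"
  define P where "P = {p. prime p \<and> real p \<le> y}"
  have \<delta>: "0 < \<delta>" "\<delta> \<le> 1 / 2" using assms by (auto simp: \<delta>_def field_simps)
  have finP: "finite P"
    by (rule finite_subset[of _ "{..nat \<lfloor>y\<rfloor>}"]) (auto simp: P_def le_nat_floor)
  \<comment> \<open>The first bound gives 1 / (1 - w p) \<le> 4, the second has 3 as a bound for
    \<open>exp 1\<close>. Together they produce the constant 12 = 3 * 4.\<close>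
  have w: "w p \<le> 3 / 4" "w p \<le> 3 / real p" if "p \<in> P" for p
  proof -
    have p2: "p \<ge> 2" using that by (auto simp: P_def prime_ge_2_nat)
    have "w p \<le> 2 powr (\<delta> - 1)"
      unfolding w_def using p2 \<delta> by (intro powr_mono2') auto
    also have "\<dots> \<le> 2 powr (- (1 / 2))" using \<delta> by (intro powr_mono) auto
    also have "\<dots> = 1 / sqrt 2" using powr_minus_divide[of "2::real" "1 / 2"] powr_half_sqrt[of 2] by simp
    also have "\<dots> \<le> 3 / 4"
    proof -
      have "4 / 3 \<le> sqrt 2" by (rule real_le_rsqrt) (simp add: power2_eq_square)
      then show ?thesis by (simp add: field_simps)
    qed
    finally show "w p \<le> 3 / 4" .
    have "real p powr \<delta> \<le> y powr \<delta>" using that p2 \<delta> by (intro powr_mono2) (auto simp: P_def)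
    also have "\<dots> = exp 1" using y0 assms by (simp add: powr_def \<delta>_def)
    also have "\<dots> \<le> 3" by (rule exp_le)
    finally show "w p \<le> 3 / real p"
      unfolding w_def using p2 by (simp add: powr_diff divide_right_mono)
  qed
  have w0: "w n \<ge> 0" for n by (simp add: w_def)
  have "(\<Sum>n\<in>S. 1 / real n) \<le> (\<Sum>n\<in>S. z powr (- \<delta>) * w n)"
  proof (rule sum_mono)
    fix n assume n: "n \<in> S"
    then have zn: "z \<le> real n" "real n > 0" using assms by force+
    have "1 \<le> (real n / z) powr \<delta>" using zn assms \<delta> by (intro ge_one_powr_ge_zero) auto
    then have "1 / real n \<le> (real n / z) powr \<delta> / real n" using zn by (intro divide_right_mono) auto
    also have "\<dots> = z powr (- \<delta>) * w n"
      unfolding w_def using zn assms by (simp add: powr_divide powr_diff powr_minus field_simps)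
    finally show "1 / real n \<le> z powr (- \<delta>) * w n" .
  qed
  also have "\<dots> = z powr (- \<delta>) * (\<Sum>n\<in>S. w n)" by (simp add: sum_distrib_left)
  also have "(\<Sum>n\<in>S. w n) = (\<Sum>n | n \<in> S \<and> n > 0 \<and> prime_factors n \<subseteq> P. w n)"
    using assms by (intro sum.cong refl) (force simp: P_def in_prime_factors_iff)
  also have "\<dots> \<le> (\<Prod>p\<in>P. 1 / (1 - w p))"
  proof (rule sum_smooth_le[OF _ _ w0 finP _ assms(1)])
    show "w (m * n) = w m * w n" for m n by (simp add: w_def powr_mult)
    show "prime p \<and> w p < 1" if "p \<in> P" for p using that w(1)[OF that] by (simp add: P_def)
  qed (simp add: w_def)
  also have "\<dots> \<le> (\<Prod>p\<in>P. exp (12 / real p))"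
  proof (rule prod_mono, intro conjI)
    fix p assume p: "p \<in> P"
    then have "real p > 0" by (auto simp: P_def prime_gt_0_nat)
    show "0 \<le> 1 / (1 - w p)" using w[OF p] by simp
    have "1 / (1 - w p) = 1 + w p * (1 / (1 - w p))" using w[OF p] by (simp add: field_simps)
    also have "\<dots> \<le> 1 + w p * 4"
      using w[OF p] w0[of p] by (intro add_left_mono mult_left_mono) (auto simp: field_simps)
    also have "\<dots> \<le> 1 + 12 / real p" using w[OF p] by simp
    also have "\<dots> \<le> exp (12 / real p)" using exp_ge_add_one_self .
    finally show "1 / (1 - w p) \<le> exp (12 / real p)" .
  qed
  also have "\<dots> = exp (\<Sum>p\<in>P. 12 / real p)" using finP by (simp add: exp_sum)
  also have "\<dots> \<le> exp (12 * ln y)"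
  proof -
    define M where "M = nat \<lfloor>y\<rfloor>"
    have M: "M > 0" "real M \<le> y" using y0 by (auto simp: M_def of_nat_nat)
    have "(\<Sum>p\<in>P. 12 / real p) \<le> (\<Sum>p\<in>{2..M}. 12 / real p)"
      using y0 by (intro sum_mono2) (auto simp: P_def M_def le_nat_floor prime_ge_2_nat)
    \<comment> \<open>Starting the sum at 2 cancels the 1 in harm M \<le> 1 + ln M, so that no
      constant accompanies 12 ln y.\<close>
    also have "\<dots> = 12 * (harm M - 1)"
    proof -
      have "{1..M} = insert 1 {2..M}" using M by auto
      then show ?thesis by (simp add: harm_def sum_distrib_left divide_inverse)
    qed
    also have "\<dots> \<le> 12 * ln (real M)" using harm_le_ln[OF M(1)] by simp
    also have "\<dots> \<le> 12 * ln y" using M by simp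
    finally show ?thesis by simp
  qed
  finally have "(\<Sum>n\<in>S. 1 / real n) \<le> z powr (- \<delta>) * exp (12 * ln y)" by (simp add: mult_left_mono)
  also have "\<dots> = exp (- ln z / ln y + 12 * ln y)"
    using assms by (simp add: powr_def \<delta>_def flip: exp_add)
  finally show ?thesis .
qed

section \<open>Sums over large moduli and over residue classes\<close>

text \<open>Telescoping against 2 / sqrt n. The exponent 3/2 is the common one: it arises from the
  counts with a rounding error, and the sums of 1 / r^2 are weakened to it so that a single tail
  bound serves everywhere.\<close>

lemma sum_inverse_sqrt_cube_le:
  assumes "finite S" "m \<ge> 1" "\<And>r. r \<in> S \<Longrightarrow> m < r"
  shows "(\<Sum>r\<in>S. 1 / (real r * sqrt (real r))) \<le> 2 / sqrt (real m)"
proof -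
  define M where "M = Max (insert m S)"
  have M: "m \<le> M" "S \<subseteq> {m<..M}" using assms by (auto simp: M_def)
  have "(\<Sum>r\<in>S. 1 / (real r * sqrt (real r))) \<le> (\<Sum>r\<in>{m<..M}. 1 / (real r * sqrt (real r)))"
    using M by (intro sum_mono2) auto
  also have "\<dots> \<le> 2 / sqrt (real m) - 2 / sqrt (real M)"
    using M(1)
  proof (induction M rule: dec_induct)
    case (step n)
    define a b where "a = sqrt (real n)" and "b = sqrt (real (Suc n))"
    have ab: "0 < a" "a \<le> b" "b\<^sup>2 = a\<^sup>2 + 1" "real (Suc n) = b\<^sup>2"
      using step assms by (auto simp: a_def b_def)
    have "a * b * (a + b) \<le> b * b * (b + b)" using ab by (intro mult_mono) auto
    then have "2 / (b * b * (b + b)) \<le> 2 / (a * b * (a + b))"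
      using ab by (intro divide_left_mono mult_pos_pos) auto
    moreover have "b - a = 1 / (a + b)" using ab by (simp add: field_simps power2_eq_square)
    then have "2 / (a * b * (a + b)) = 2 * (b - a) / (a * b)" by simp
    also have "\<dots> = 2 / a - 2 / b" using ab by (simp add: field_simps)
    ultimately have "1 / (b\<^sup>2 * b) \<le> 2 / a - 2 / b"
      using ab by (simp add: power2_eq_square mult.commute)
    moreover have "{m<..Suc n} = insert (Suc n) {m<..n}" using step by auto
    ultimately show ?case using step unfolding ab(4)[symmetric] by (simp add: a_def b_def)
  qed simp
  also have "\<dots> \<le> 2 / sqrt (real m)" by simp
  finally show ?thesis .
qed

lemma sum_inverse_sqrt_cube_tail:
  fixes z :: real
  assumes "finite S" "z \<ge> 1" "\<And>r. r \<in> S \<Longrightarrow> z < real r"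
  shows "(\<Sum>r\<in>S. 1 / (real r * sqrt (real r))) \<le> 3 / sqrt z"
proof -
  define m where "m = nat \<lfloor>z\<rfloor>"
  have m: "m \<ge> 1" "real m \<le> z" "z < real m + 1"
    using assms(2) by (auto simp: m_def of_nat_nat le_nat_floor)
  have "(\<Sum>r\<in>S. 1 / (real r * sqrt (real r))) \<le> 2 / sqrt (real m)"
    using assms m by (intro sum_inverse_sqrt_cube_le) force+
  also have "\<dots> \<le> 3 / sqrt z"
  proof -
    \<comment> \<open>From z < m + 1 \<le> 2 m; rounding z down turns the constant 2 into 3.\<close>
    have "sqrt (4 * z) \<le> sqrt (9 * real m)" using m by (intro real_sqrt_le_mono) linarith
    then have "2 * sqrt z \<le> 3 * sqrt (real m)" by (simp add: real_sqrt_mult)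
    then show ?thesis using m assms by (simp add: field_simps)
  qed
  finally show ?thesis .
qed

lemma sum_inverse_sqrt_cube_total:
  assumes "finite S" "0 \<notin> S"
  shows "(\<Sum>r\<in>S. 1 / (real r * sqrt (real r))) \<le> 3"
proof -
  have "(\<Sum>r\<in>S. 1 / (real r * sqrt (real r))) \<le> (\<Sum>r\<in>insert 1 (S - {1}). 1 / (real r * sqrt (real r)))"
    using assms by (intro sum_mono2) auto
  also have "\<dots> = 1 + (\<Sum>r\<in>S - {1}. 1 / (real r * sqrt (real r)))"
    using assms by (subst sum.insert) auto
  also have "(\<Sum>r\<in>S - {1}. 1 / (real r * sqrt (real r))) \<le> 2 / sqrt (real 1)"
  proof (rule sum_inverse_sqrt_cube_le)
    fix r assume "r \<in> S - {1}" then show "1 < r" using assms by (cases r) auto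
  qed (use assms in auto)
  finally show ?thesis by simp
qed

text \<open>Write q + 1 = r j and use 1 / q \<le> 2 / (q + 1), so that a harmonic sum over j
  remains. In the applications q is prime; forgetting this costs only a logarithm.\<close>

lemma sum_inverse_minus_one_class:
  assumes "Q \<subseteq> {1..N}" "r \<ge> 2" "\<And>q. q \<in> Q \<Longrightarrow> r dvd q + 1"
  shows "(\<Sum>q\<in>Q. 1 / real q) \<le> 2 / real r * harm N"
proof -
  have eq: "q + 1 = r * ((q + 1) div r)" if "q \<in> Q" for q using assms(3)[OF that] by simp
  have finQ: "finite Q" using assms(1) finite_subset by blast
  have inj: "inj_on (\<lambda>q. (q + 1) div r) Q"
    by (rule inj_onI) (metis eq add_right_cancel)
  have "(\<Sum>q\<in>Q. 1 / real q) \<le> (\<Sum>q\<in>Q. 2 / real r * (1 / real ((q + 1) div r)))"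
  proof (rule sum_mono)
    fix q assume q: "q \<in> Q"
    have "real r * real ((q + 1) div r) = real (q + 1)" using eq[OF q] by (metis of_nat_mult)
    then have "2 / real r * (1 / real ((q + 1) div r)) = 2 / real (q + 1)" by simp
    moreover have "1 / real q \<le> 2 / real (q + 1)" using q assms(1) by (auto simp: field_simps)
    ultimately show "1 / real q \<le> 2 / real r * (1 / real ((q + 1) div r))" by simp
  qed
  also have "\<dots> = 2 / real r * (\<Sum>j\<in>(\<lambda>q. (q + 1) div r) ` Q. 1 / real j)"
    using inj by (simp add: sum.reindex sum_distrib_left)
  also have "(\<Sum>j\<in>(\<lambda>q. (q + 1) div r) ` Q. 1 / real j) \<le> (\<Sum>j\<in>{1..N}. 1 / real j)"
  proof (intro sum_mono2 image_subsetI)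
    fix q assume q: "q \<in> Q"
    define j where "j = (q + 1) div r"
    have j: "q + 1 = r * j" using eq[OF q] by (simp add: j_def)
    have "j \<noteq> 0" using j by (cases "j = 0") auto
    moreover have "2 * j \<le> r * j" using assms(2) by (rule mult_right_mono) simp
    ultimately have "1 \<le> j" "j \<le> q" using j by linarith+
    then show "(q + 1) div r \<in> {1..N}" using q assms(1) by (auto simp: j_def)
  qed auto
  also have "\<dots> = harm N" by (simp add: harm_def divide_inverse)
  finally show ?thesis by (simp add: mult_left_mono divide_right_mono)
qed

text \<open>The difference of a and b + h is r j with j \<ge> 1; excluding equality is what yields
  the saving of r. If a is larger, then a \<ge> r j and the pair is coded by (b, j). If a is
  smaller, then r j \<le> b + h with h \<le> r j / 2, so b \<ge> r j / 2 and the pair is coded by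
  (a, j). The two cases contribute 1 and 2 to the constant 3.\<close>

lemma sum_inverse_pairs_cong:
  fixes h r N :: nat
  assumes S: "S \<subseteq> {1..N} \<times> {1..N}" and r: "r \<ge> 2" "r \<ge> 2 * h"
    and cong: "\<And>a b. (a, b) \<in> S \<Longrightarrow> [a = b + h] (mod r) \<and> a \<noteq> b + h"
  shows "(\<Sum>(a, b)\<in>S. 1 / (real a * real b)) \<le> 3 * (harm N)\<^sup>2 / real r"
proof -
  have finS: "finite S" using S finite_subset by blast
  define S1 where "S1 = {(a, b) \<in> S. a > b + h}"
  define S2 where "S2 = {(a, b) \<in> S. a < b + h}"
  have S12: "S = S1 \<union> S2" "S1 \<inter> S2 = {}" using cong by (fastforce simp: S1_def S2_def)+
  have fin: "finite S1" "finite S2" using finS S12 by auto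
  have box: "(\<Sum>(b, j)\<in>{1..N} \<times> {1..N}. 1 / (real b * real j)) = (harm N)\<^sup>2"
    by (simp add: harm_def power2_eq_square sum_product sum.cartesian_product divide_inverse)
  have 1: "(\<Sum>(a, b)\<in>S1. 1 / (real a * real b)) \<le> (harm N)\<^sup>2 / real r"
  proof -
    define \<phi> where "\<phi> = (\<lambda>(a, b). (b, (a - (b + h)) div r))"
    have el: "a = b + h + r * ((a - (b + h)) div r) \<and> \<phi> (a, b) \<in> {1..N} \<times> {1..N}" if "(a, b) \<in> S1" for a b
    proof -
      have ab: "(a, b) \<in> S" "a > b + h" using that by (auto simp: S1_def)
      then have "r dvd a - (b + h)" using cong[of a b] by (metis cong_altdef_nat less_imp_le)
      then obtain j where j: "a - (b + h) = r * j" by auto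
      have "j \<noteq> 0" using j ab by (cases "j = 0") auto
      moreover have "j \<le> r * j" using r by simp
      moreover have "a \<le> N" using ab S by auto
      ultimately have "1 \<le> j" "j \<le> N" using j by linarith+
      then show ?thesis using j ab S r by (auto simp: \<phi>_def)
    qed
    have "inj_on \<phi> S1"
    proof (rule inj_onI)
      fix x x' assume x: "x \<in> S1" "x' \<in> S1" "\<phi> x = \<phi> x'"
      obtain a b a' b' where ab: "x = (a, b)" "x' = (a', b')" by (metis surj_pair)
      show "x = x'" using el[of a b] el[of a' b'] x by (auto simp: ab \<phi>_def)
    qed
    have "(\<Sum>(a, b)\<in>S1. 1 / (real a * real b)) \<le> (\<Sum>x\<in>S1. (\<lambda>(b, j). 1 / (real b * real j) / real r) (\<phi> x))"
    proof (rule sum_mono, clarify)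
      fix a b assume ab: "(a, b) \<in> S1"
      define j where "j = (a - (b + h)) div r"
      have j: "a = b + h + r * j" "j \<ge> 1" "b \<ge> 1" using el[OF ab] by (auto simp: \<phi>_def j_def)
      have "real r * real j \<le> real a" using j by simp
      moreover have "real a > 0" "real b > 0" "real j > 0" "real r > 0" using j r by linarith+
      ultimately have "1 / (real a * real b) \<le> 1 / ((real r * real j) * real b)"
        by (intro divide_left_mono mult_right_mono mult_pos_pos) simp_all
      then show "1 / (real a * real b) \<le> (\<lambda>(b, j). 1 / (real b * real j) / real r) (\<phi> (a, b))"
        by (simp add: \<phi>_def j_def mult_ac)
    qed
    also have "\<dots> = (\<Sum>(b, j)\<in>\<phi> ` S1. 1 / (real b * real j) / real r)"
      using \<open>inj_on \<phi> S1\<close> by (simp add: sum.reindex)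
    also have "\<dots> \<le> (\<Sum>(b, j)\<in>{1..N} \<times> {1..N}. 1 / (real b * real j) / real r)"
    proof (rule sum_mono2)
      show "\<phi> ` S1 \<subseteq> {1..N} \<times> {1..N}"
        using el by (intro image_subsetI) (metis surj_pair)
    qed auto
    also have "\<dots> = (harm N)\<^sup>2 / real r"
      unfolding box[symmetric] by (simp add: sum_divide_distrib case_prod_unfold)
    finally show ?thesis .
  qed
  have 2: "(\<Sum>(a, b)\<in>S2. 1 / (real a * real b)) \<le> 2 * (harm N)\<^sup>2 / real r"
  proof -
    define \<phi> where "\<phi> = (\<lambda>(a, b). (a, (b + h - a) div r))"
    have el: "b + h = a + r * ((b + h - a) div r) \<and> \<phi> (a, b) \<in> {1..N} \<times> {1..N}
        \<and> r * ((b + h - a) div r) \<le> 2 * b" if "(a, b) \<in> S2" for a b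
    proof -
      have ab: "(a, b) \<in> S" "a < b + h" using that by (auto simp: S2_def)
      then have "r dvd b + h - a" using cong[of a b] by (metis cong_altdef_nat cong_sym less_imp_le)
      then obtain j where j: "b + h - a = r * j" by auto
      have j0: "j \<noteq> 0" using j ab by (cases "j = 0") auto
      then have "r \<le> r * j" by simp
      then have "2 * h \<le> r * j" using r by linarith
      then have jb: "r * j \<le> 2 * b" using j ab by linarith
      moreover have "2 * j \<le> r * j" using r(1) by (rule mult_right_mono) simp
      moreover have "b \<le> N" "1 \<le> a" "a \<le> N" using ab S by auto
      ultimately have "1 \<le> j" "j \<le> N" using j0 by linarith+
      then show ?thesis using j ab S r jb by (auto simp: \<phi>_def)
    qed
    have "inj_on \<phi> S2"
    proof (rule inj_onI)
      fix x x' assume x: "x \<in> S2" "x' \<in> S2" "\<phi> x = \<phi> x'"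
      obtain a b a' b' where ab: "x = (a, b)" "x' = (a', b')" by (metis surj_pair)
      show "x = x'" using el[of a b] el[of a' b'] x by (auto simp: ab \<phi>_def)
    qed
    have "(\<Sum>(a, b)\<in>S2. 1 / (real a * real b)) \<le> (\<Sum>x\<in>S2. (\<lambda>(b, j). 1 / (real b * real j) * (2 / real r)) (\<phi> x))"
    proof (rule sum_mono, clarify)
      fix a b assume ab: "(a, b) \<in> S2"
      define j where "j = (b + h - a) div r"
      have j: "r * j \<le> 2 * b" "j \<ge> 1" "a \<ge> 1" using el[OF ab] by (auto simp: \<phi>_def j_def)
      have "b \<ge> 1" using ab S by (auto simp: S2_def)
      have "real r * real j \<le> 2 * real b" using j(1) by (metis of_nat_le_iff of_nat_mult of_nat_numeral)
      moreover have "real a > 0" "real b > 0" "real j > 0" "real r > 0" using j r \<open>b \<ge> 1\<close> by linarith+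
      ultimately have "1 / (real a * real b) \<le> 1 / (real a * (real r * real j / 2))"
        by (intro divide_left_mono mult_left_mono mult_pos_pos) simp_all
      then show "1 / (real a * real b) \<le> (\<lambda>(b, j). 1 / (real b * real j) * (2 / real r)) (\<phi> (a, b))"
        by (simp add: \<phi>_def j_def mult_ac)
    qed
    also have "\<dots> = (\<Sum>(b, j)\<in>\<phi> ` S2. 1 / (real b * real j) * (2 / real r))"
      using \<open>inj_on \<phi> S2\<close> by (simp add: sum.reindex)
    also have "\<dots> \<le> (\<Sum>(b, j)\<in>{1..N} \<times> {1..N}. 1 / (real b * real j) * (2 / real r))"
    proof (rule sum_mono2)
      show "\<phi> ` S2 \<subseteq> {1..N} \<times> {1..N}"
        using el by (intro image_subsetI) (metis surj_pair)
    qed auto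
    also have "\<dots> = (harm N)\<^sup>2 * (2 / real r)"
      unfolding box[symmetric] by (simp only: sum_distrib_right case_prod_unfold)
    finally show ?thesis by (simp add: mult.commute)
  qed
  have "(\<Sum>(a, b)\<in>S. 1 / (real a * real b)) = (\<Sum>(a, b)\<in>S1. 1 / (real a * real b)) + (\<Sum>(a, b)\<in>S2. 1 / (real a * real b))"
    unfolding S12(1) using fin S12(2) by (rule sum.union_disjoint)
  then show ?thesis using 1 2 by (simp add: field_simps)
qed

section \<open>The sum of divisors and exceptional integers\<close>

lemma sigma_mult_coprime:
  assumes "coprime a b" "a > 0" "b > 0"
  shows "sigma (a * b) = sigma a * sigma b"
proof -
  let ?f = "\<lambda>(d, e). d * e :: nat"
  have "inj_on ?f ({d. d dvd a} \<times> {e. e dvd b})"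
  proof (rule inj_onI, clarify)
    fix d e d' e' assume d: "d dvd a" "e dvd b" "d' dvd a" "e' dvd b" and eq: "d * e = d' * e'"
    have cop: "coprime x y" if "x dvd a" "y dvd b" for x y
      using assms(1) that by (meson coprime_divisors)
    have "d dvd d'"
      using eq d cop[of d e'] by (metis coprime_dvd_mult_left_iff dvd_triv_left)
    moreover have "d' dvd d"
      using eq d cop[of d' e] by (metis coprime_dvd_mult_left_iff dvd_triv_left)
    ultimately have "d = d'" by (rule dvd_antisym)
    moreover have "d' > 0" using d assms by (metis dvd_0_left_iff gr0I)
    ultimately show "d = d' \<and> e = e'" using eq by simp
  qed
  moreover have "?f ` ({d. d dvd a} \<times> {e. e dvd b}) = {c. c dvd a * b}"
    by (auto simp: image_iff intro: mult_dvd_mono dest: division_decomp)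
  ultimately have "sigma (a * b) = (\<Sum>(d, e)\<in>{d. d dvd a} \<times> {e. e dvd b}. d * e)"
    unfolding sigma_def by (metis (no_types, lifting) case_prod_unfold sum.cong sum.reindex_cong)
  also have "\<dots> = sigma a * sigma b"
    by (simp add: sigma_def sum_product sum.cartesian_product)
  finally show ?thesis .
qed

lemma sigma_prime_power:
  assumes "prime p"
  shows "sigma (p ^ e) = (\<Sum>i\<le>e. p ^ i)"
proof -
  have "{d. d dvd p ^ e} = (\<lambda>i. p ^ i) ` {..e}"
    using divides_primepow_nat[OF assms] by auto
  moreover have "inj_on (\<lambda>i. p ^ i) {..e}"
    using prime_gt_1_nat[OF assms] by (auto simp: inj_on_def)
  ultimately show ?thesis by (simp add: sigma_def sum.reindex)
qed

lemma sigma_prime: "prime p \<Longrightarrow> sigma p = p + 1"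
  using sigma_prime_power[of p 1] by simp

text \<open>Used to see that a prime power whose sum of divisors is divisible by r exceeds r /
  2.\<close>

lemma sigma_prime_power_less:
  assumes "prime p"
  shows "sigma (p ^ e) < 2 * p ^ e"
proof -
  have "(\<Sum>i\<le>e. p ^ i) < 2 * p ^ e"
  proof (induction e)
    case (Suc e)
    have "2 * p ^ e \<le> p * p ^ e" using prime_ge_2_nat[OF assms] by (rule mult_right_mono) simp
    then have "(\<Sum>i\<le>e. p ^ i) < p * p ^ e" using Suc by (rule less_le_trans[rotated])
    then show ?case by simp
  qed simp
  then show ?thesis by (simp add: sigma_prime_power[OF assms])
qed

text \<open>The sum of divisors is the product of its values at the exact prime powers of m, and a
  prime dividing a product divides a factor. The induction splits off one exact prime power at a
  time.\<close>

lemma prime_dvd_sigma: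
  assumes "prime r" "m > 0" "r dvd sigma m"
  shows "\<exists>q e. prime q \<and> e > 0 \<and> q ^ e dvd m \<and> r dvd sigma (q ^ e)"
  using assms(2,3)
proof (induction m rule: less_induct)
  case (less m)
  have "m \<noteq> 1"
  proof
    assume "m = 1"
    moreover have "{d::nat. d dvd 1} = {1}" by auto
    ultimately have "r dvd 1" using less.prems by (simp add: sigma_def)
    then show False using assms(1) by simp
  qed
  then obtain q where q: "prime q" "q dvd m" using prime_factor_nat by blast
  define e where "e = multiplicity q m"
  obtain m' where m': "m = q ^ e * m'" by (metis e_def dvdE multiplicity_dvd)
  have e: "e > 0" using q less.prems by (auto simp: e_def prime_multiplicity_gt_zero_iff)
  have "m' > 0" using m' less.prems by (cases "m' = 0") auto
  have "\<not> q dvd m'"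
  proof
    assume "q dvd m'"
    then have "q ^ Suc e dvd m" by (auto simp: m')
    then show False using q less.prems
      by (metis Suc_n_not_le_n e_def multiplicity_geI neq0_conv not_prime_unit)
  qed
  then have cop: "coprime (q ^ e) m'" using q prime_imp_coprime by auto
  have "q ^ e > 0" using q prime_gt_0_nat by simp
  then have "r dvd sigma (q ^ e) * sigma m'"
    using less.prems(2) sigma_mult_coprime[OF cop _ \<open>m' > 0\<close>] by (simp add: m')
  then consider "r dvd sigma (q ^ e)" | "r dvd sigma m'" using assms(1) prime_dvd_mult_iff by blast
  then show ?case
  proof cases
    case 1
    then show ?thesis using q(1) e by (intro exI[of _ q] exI[of _ e]) (simp add: m')
  next
    case 2
    have "1 < q ^ e" using e prime_gt_1_nat[OF q(1)] by (intro one_less_power)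
    then have "m' < m" using m' \<open>m' > 0\<close> by simp
    then obtain q' e' where "prime q'" "e' > 0" "q' ^ e' dvd m'" "r dvd sigma (q' ^ e')"
      using less.IH[OF _ \<open>m' > 0\<close> 2] by blast
    then show ?thesis by (intro exI[of _ q'] exI[of _ e']) (simp add: m')
  qed
qed

section \<open>The union bound and the sizes of the exceptional sets\<close>

lemma card_UN_le_sum:
  fixes f :: "'a \<Rightarrow> real"
  assumes "finite I" "\<And>i. i \<in> I \<Longrightarrow> real (card (A i)) \<le> f i" "S \<subseteq> (\<Union>i\<in>I. A i)" "\<And>i. i \<in> I \<Longrightarrow> finite (A i)"
  shows "real (card S) \<le> (\<Sum>i\<in>I. f i)"
proof -
  have "card S \<le> card (\<Union>i\<in>I. A i)" using assms by (intro card_mono) auto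
  also have "\<dots> \<le> (\<Sum>i\<in>I. card (A i))" using assms(1) by (rule card_UN_le)
  finally have "real (card S) \<le> (\<Sum>i\<in>I. real (card (A i)))" by (metis of_nat_mono of_nat_sum)
  also have "\<dots> \<le> (\<Sum>i\<in>I. f i)" using assms(2) by (rule sum_mono)
  finally show ?thesis .
qed

text \<open>There is no rounding term: n + k is positive, so the quotient (n + k) / d runs through
  {1..(N + k) div d}. This matters because the bound is summed over many d, including d > N.\<close>

lemma card_multiples_le:
  assumes "d > 0" "k \<le> N"
  shows "real (card {n \<in> {1..N}. d dvd n + k}) \<le> 2 * real N / real d"
proof -
  have "card {n \<in> {1..N}. d dvd n + k} \<le> card {1..(N + k) div d}"
  proof (rule card_inj_on_le[of "\<lambda>n. (n + k) div d"])
    show "inj_on (\<lambda>n. (n + k) div d) {n \<in> {1..N}. d dvd n + k}"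
      by (rule inj_onI) (metis (no_types, lifting) add_right_cancel dvd_mult_div_cancel mem_Collect_eq)
    show "(\<lambda>n. (n + k) div d) ` {n \<in> {1..N}. d dvd n + k} \<subseteq> {1..(N + k) div d}"
    proof (rule image_subsetI)
      fix n assume n: "n \<in> {n \<in> {1..N}. d dvd n + k}"
      have "d \<le> n + k" using n by (intro dvd_imp_le) auto
      then have "(n + k) div d > 0" using assms by (simp add: div_greater_zero_iff)
      moreover have "(n + k) div d \<le> (N + k) div d" using n by (intro div_le_mono) auto
      ultimately show "(n + k) div d \<in> {1..(N + k) div d}" by auto
    qed
  qed simp
  then have "real (card {n \<in> {1..N}. d dvd n + k}) \<le> real ((N + k) div d)" by simp
  also have "\<dots> \<le> real (N + k) / real d" using real_div_bounds(1)[OF assms(1)] .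
  also have "\<dots> \<le> 2 * real N / real d" using assms by (intro divide_right_mono) auto
  finally show ?thesis .
qed

text \<open>Integers up to z are counted trivially; beyond z, 1 \<le> N / n turns the count into the
  reciprocal sum treated by Rankin's trick.\<close>

lemma card_smooth_le:
  fixes y z :: real
  assumes "z > 0" "y > 1" "ln y \<ge> 2"
  shows "real (card {n \<in> {1..N}. \<forall>p. prime p \<and> p dvd n \<longrightarrow> real p \<le> y})
    \<le> z + real N * exp (- ln z / ln y + 12 * ln y)"
proof -
  let ?S = "{n \<in> {1..N}. \<forall>p. prime p \<and> p dvd n \<longrightarrow> real p \<le> y}"
  have "card {n \<in> ?S. real n \<le> z} \<le> card {1..nat \<lfloor>z\<rfloor>}"
    by (intro card_mono) (auto simp: le_nat_floor)
  then have 1: "real (card {n \<in> ?S. real n \<le> z}) \<le> z"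
    using assms(1) by (simp add: le_nat_floor) linarith
  have "real (card {n \<in> ?S. z < real n}) = (\<Sum>n | n \<in> ?S \<and> z < real n. 1)" by simp
  also have "\<dots> \<le> (\<Sum>n | n \<in> ?S \<and> z < real n. real N * (1 / real n))"
    by (rule sum_mono) auto
  also have "\<dots> = real N * (\<Sum>n | n \<in> ?S \<and> z < real n. 1 / real n)" by (simp add: sum_distrib_left)
  also have "\<dots> \<le> real N * exp (- ln z / ln y + 12 * ln y)"
    using assms by (intro mult_left_mono sum_smooth_tail_le) auto
  finally have 2: "real (card {n \<in> ?S. z < real n}) \<le> real N * exp (- ln z / ln y + 12 * ln y)" .
  have "card ?S \<le> card ({n \<in> ?S. real n \<le> z} \<union> {n \<in> ?S. z < real n})"
    by (rule card_mono) auto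
  also have "\<dots> \<le> card {n \<in> ?S. real n \<le> z} + card {n \<in> ?S. z < real n}"
    by (rule card_Un_le)
  finally show ?thesis using 1 2 by linarith
qed

text \<open>Serves twice: with k = 0 to make the large prime p divide n only once, and with k = h to
  exclude higher prime powers dividing n + h.\<close>

lemma card_large_square_divisor_le:
  fixes z :: real
  assumes "z \<ge> 1" "k \<le> N"
  shows "real (card {n \<in> {1..N}. \<exists>m. z < real m \<and> m * m dvd n + k}) \<le> 6 * real N / sqrt z"
proof -
  let ?I = "{m \<in> {1..2 * N}. z < real m}"
  have "real (card {n \<in> {1..N}. \<exists>m. z < real m \<and> m * m dvd n + k})
    \<le> (\<Sum>m\<in>?I. 2 * real N * (1 / (real m * sqrt (real m))))"
  proof (rule card_UN_le_sum[where A = "\<lambda>m. {n \<in> {1..N}. m * m dvd n + k}"])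
    fix m assume m: "m \<in> ?I"
    have "real (card {n \<in> {1..N}. m * m dvd n + k}) \<le> 2 * real N / real (m * m)"
      using m assms by (intro card_multiples_le) auto
    also have "\<dots> \<le> 2 * real N / (real m * sqrt (real m))"
    proof -
      have "real m \<le> real m * real m" using m by (simp flip: of_nat_mult)
      then have "sqrt (real m) \<le> sqrt (real m * real m)" by (rule real_sqrt_le_mono)
      then have "sqrt (real m) \<le> real m" by simp
      then have "real m * sqrt (real m) \<le> real m * real m" by (intro mult_left_mono) auto
      then show ?thesis using m by (intro divide_left_mono) auto
    qed
    finally show "real (card {n \<in> {1..N}. m * m dvd n + k}) \<le> 2 * real N * (1 / (real m * sqrt (real m)))" by simp
  next
    show "{n \<in> {1..N}. \<exists>m. z < real m \<and> m * m dvd n + k} \<subseteq> (\<Union>m\<in>?I. {n \<in> {1..N}. m * m dvd n + k})"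
    proof
      fix n assume "n \<in> {n \<in> {1..N}. \<exists>m. z < real m \<and> m * m dvd n + k}"
      then obtain m where m: "n \<in> {1..N}" "z < real m" "m * m dvd n + k" by auto
      have "m \<le> m * m" by simp
      also have "\<dots> \<le> n + k" using m by (intro dvd_imp_le) auto
      finally have "m \<in> ?I" using m assms by auto
      then show "n \<in> (\<Union>m\<in>?I. {n \<in> {1..N}. m * m dvd n + k})" using m by blast
    qed
  qed auto
  also have "\<dots> = 2 * real N * (\<Sum>m\<in>?I. 1 / (real m * sqrt (real m)))" by (simp add: sum_distrib_left)
  also have "\<dots> \<le> 2 * real N * (3 / sqrt z)"
    using assms by (intro mult_left_mono sum_inverse_sqrt_cube_tail) auto
  finally show ?thesis by simp
qed

text \<open>Rankin's trick is applied to the integers p + 1, which exceed y and have only prime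
  factors up to L. The inequality 1 / p \<le> 2 / (p + 1) passes to their reciprocals.\<close>

lemma card_smooth_shifted_prime_le:
  fixes y L :: real
  assumes "y > 1" "L > 1" "ln L \<ge> 2"
  shows "real (card {n \<in> {1..N}. \<exists>p. prime p \<and> y < real p \<and> p dvd n \<and>
      (\<forall>r. prime r \<and> r dvd p + 1 \<longrightarrow> real r \<le> L)})
    \<le> 4 * real N * exp (- ln y / ln L + 12 * ln L)"
proof -
  let ?I = "{p \<in> {1..N}. y < real p \<and> (\<forall>r. prime r \<and> r dvd p + 1 \<longrightarrow> real r \<le> L)}"
  have "real (card {n \<in> {1..N}. \<exists>p. prime p \<and> y < real p \<and> p dvd n \<and>
      (\<forall>r. prime r \<and> r dvd p + 1 \<longrightarrow> real r \<le> L)}) \<le> (\<Sum>p\<in>?I. 4 * real N * (1 / real (p + 1)))"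
  proof (rule card_UN_le_sum[where A = "\<lambda>p. {n \<in> {1..N}. p dvd n + 0}"])
    fix p assume p: "p \<in> ?I"
    have "real (card {n \<in> {1..N}. p dvd n + 0}) \<le> 2 * real N / real p"
      using p by (intro card_multiples_le) auto
    also have "\<dots> \<le> 4 * real N * (1 / real (p + 1))" using p by (simp add: field_simps)
    finally show "real (card {n \<in> {1..N}. p dvd n + 0}) \<le> 4 * real N * (1 / real (p + 1))" .
  next
    show "{n \<in> {1..N}. \<exists>p. prime p \<and> y < real p \<and> p dvd n \<and>
      (\<forall>r. prime r \<and> r dvd p + 1 \<longrightarrow> real r \<le> L)} \<subseteq> (\<Union>p\<in>?I. {n \<in> {1..N}. p dvd n + 0})"
    proof
      fix n assume "n \<in> {n \<in> {1..N}. \<exists>p. prime p \<and> y < real p \<and> p dvd n \<and>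
        (\<forall>r. prime r \<and> r dvd p + 1 \<longrightarrow> real r \<le> L)}"
      then obtain p where p: "n \<in> {1..N}" "prime p" "y < real p" "p dvd n"
        "\<forall>r. prime r \<and> r dvd p + 1 \<longrightarrow> real r \<le> L" by auto
      then have "p \<le> n" by (intro dvd_imp_le) auto
      then have "p \<in> ?I" using p prime_ge_1_nat[OF p(2)] by auto
      then show "n \<in> (\<Union>p\<in>?I. {n \<in> {1..N}. p dvd n + 0})" using p by auto
    qed
  qed auto
  also have "\<dots> = 4 * real N * (\<Sum>p\<in>?I. 1 / real (p + 1))" by (simp add: sum_distrib_left)
  also have "(\<Sum>p\<in>?I. 1 / real (p + 1)) = (\<Sum>n\<in>Suc ` ?I. 1 / real n)"
    by (subst sum.reindex) auto
  also have "\<dots> \<le> exp (- ln y / ln L + 12 * ln L)"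
    using assms by (intro sum_smooth_tail_le) auto
  finally show ?thesis by (simp add: mult_left_mono)
qed

section \<open>Pairs of large primes\<close>

text \<open>Since r divides q + 1, it is coprime to q, so r q divides n + h; the sum of 1 / q over
  this class saves another r. Once these n are removed, r does not divide the cofactor b, which the
  count modulo an lcm relies on.\<close>

lemma card_dvd_shift_class_le:
  fixes L :: real
  assumes "L \<ge> 2" "h \<le> N"
  shows "real (card {n \<in> {1..N}. \<exists>r q. L < real r \<and> r dvd q + 1 \<and> q dvd n + h \<and> r dvd n + h})
    \<le> 12 * real N * harm (2 * N) / sqrt L"
proof -
  let ?I = "{r \<in> {1..2 * N}. L < real r}"
  let ?Q = "\<lambda>r. {q \<in> {1..2 * N}. r dvd q + 1}"
  let ?A = "\<lambda>x. {n \<in> {1..N}. fst x * snd x dvd n + h}"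
  have c: "0 \<le> 4 * real N * (harm (2 * N) :: real)"
    using harm_nonneg[of "2 * N", where 'a = real] by (intro mult_nonneg_nonneg) auto
  have "real (card {n \<in> {1..N}. \<exists>r q. L < real r \<and> r dvd q + 1 \<and> q dvd n + h \<and> r dvd n + h})
    \<le> (\<Sum>x\<in>Sigma ?I ?Q. 2 * real N / (real (fst x) * real (snd x)))"
  proof (rule card_UN_le_sum[where A = ?A])
    fix x assume "x \<in> Sigma ?I ?Q"
    then have "fst x * snd x > 0" by auto
    then show "real (card (?A x)) \<le> 2 * real N / (real (fst x) * real (snd x))"
      using card_multiples_le[of "fst x * snd x" h N] assms by simp
  next
    show "{n \<in> {1..N}. \<exists>r q. L < real r \<and> r dvd q + 1 \<and> q dvd n + h \<and> r dvd n + h} \<subseteq> (\<Union>x\<in>Sigma ?I ?Q. ?A x)"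
    proof
      fix n assume "n \<in> {n \<in> {1..N}. \<exists>r q. L < real r \<and> r dvd q + 1 \<and> q dvd n + h \<and> r dvd n + h}"
      then obtain r q where n: "n \<in> {1..N}" and rq: "L < real r" "r dvd q + 1" "q dvd n + h" "r dvd n + h" by auto
      have "coprime r q"
      proof (rule coprimeI)
        fix c assume "c dvd r" "c dvd q"
        then show "c dvd 1" using rq(2) by (metis dvd_add_right_iff dvd_trans)
      qed
      then have dvd: "r * q dvd n + h" using rq by (simp add: divides_mult)
      have "q > 0" using rq n by (cases "q = 0") auto
      moreover have "r > 0" using rq assms by (cases "r = 0") auto
      moreover have "r \<le> n + h" "q \<le> n + h" using rq n by (auto intro!: dvd_imp_le)
      ultimately have "(r, q) \<in> Sigma ?I ?Q" using rq n assms by auto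
      then show "n \<in> (\<Union>x\<in>Sigma ?I ?Q. ?A x)" using dvd n by (intro UN_I[of "(r, q)"]) auto
    qed
  qed auto
  also have "\<dots> = (\<Sum>r\<in>?I. \<Sum>q\<in>?Q r. 2 * real N / (real r * real q))"
    by (subst sum.Sigma) (auto simp: case_prod_unfold)
  also have "\<dots> = (\<Sum>r\<in>?I. 2 * real N / real r * (\<Sum>q\<in>?Q r. 1 / real q))"
    by (simp add: sum_distrib_left)
  also have "\<dots> \<le> (\<Sum>r\<in>?I. 4 * real N * harm (2 * N) * (1 / (real r * sqrt (real r))))"
  proof (rule sum_mono)
    fix r assume r: "r \<in> ?I"
    have "(\<Sum>q\<in>?Q r. 1 / real q) \<le> 2 / real r * harm (2 * N)"
      using r assms by (intro sum_inverse_minus_one_class) auto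
    then have "2 * real N / real r * (\<Sum>q\<in>?Q r. 1 / real q)
      \<le> 2 * real N / real r * (2 / real r * harm (2 * N))" by (intro mult_left_mono) auto
    also have "\<dots> = 4 * real N * harm (2 * N) * (1 / (real r * real r))" by simp
    also have "\<dots> \<le> 4 * real N * harm (2 * N) * (1 / (real r * sqrt (real r)))"
    proof -
      have "real r \<le> real r * real r" using r by (simp flip: of_nat_mult)
      then have "sqrt (real r) \<le> sqrt (real r * real r)" by (rule real_sqrt_le_mono)
      then have "real r * sqrt (real r) \<le> real r * real r" by (intro mult_left_mono) auto
      then show ?thesis using r by (intro mult_left_mono[OF _ c] divide_left_mono) auto
    qed
    finally show "2 * real N / real r * (\<Sum>q\<in>?Q r. 1 / real q)
      \<le> 4 * real N * harm (2 * N) * (1 / (real r * sqrt (real r)))" .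
  qed
  also have "\<dots> = 4 * real N * harm (2 * N) * (\<Sum>r\<in>?I. 1 / (real r * sqrt (real r)))"
    by (simp add: sum_distrib_left)
  also have "\<dots> \<le> 4 * real N * harm (2 * N) * (3 / sqrt L)"
    using assms by (intro mult_left_mono[OF _ c] sum_inverse_sqrt_cube_tail) auto
  finally show ?thesis by simp
qed

text \<open>The threshold \<open>N * sqrt r\<close> is a compromise: the rounding error \<open>1\<close> in counting \<open>n\<close> modulo \<open>p * q\<close> costs only a factor
  \<open>sqrt r\<close> here, and above the threshold the cofactors \<open>a\<close>, \<open>b\<close> are small enough for \<open>card_cofactor_class_le\<close>.\<close>

lemma card_two_large_primes_le:
  fixes L :: real
  assumes "L \<ge> 2" "h \<le> N"
  shows "real (card {n \<in> {1..N}. \<exists>r p q. L < real r \<and> prime p \<and> prime q \<and> p \<noteq> q \<and> r dvd p + 1 \<and> r dvd q + 1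
      \<and> p dvd n \<and> q dvd n + h \<and> real p * real q \<le> real N * sqrt (real r)})
    \<le> 24 * real N * (harm (2 * N))\<^sup>2 / sqrt L"
proof -
  let ?I = "{r \<in> {1..2 * N}. L < real r}"
  let ?Q = "\<lambda>r. {q \<in> {1..2 * N}. r dvd q + 1}"
  \<comment> \<open>Primality, distinctness and the size condition are kept in the sets and not in
    the index set. Thus the index set is a product for each r and its sum factors into a square; the
    conditions are recovered whenever a set is nonempty.\<close>
  let ?A = "\<lambda>x. {n \<in> {1..N}. \<exists>r p q. x = (r, p, q) \<and> prime p \<and> prime q \<and> p \<noteq> q
      \<and> p dvd n \<and> q dvd n + h \<and> real p * real q \<le> real N * sqrt (real r)}"
  have "real (card {n \<in> {1..N}. \<exists>r p q. L < real r \<and> prime p \<and> prime q \<and> p \<noteq> q \<and> r dvd p + 1 \<and> r dvd q + 1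
      \<and> p dvd n \<and> q dvd n + h \<and> real p * real q \<le> real N * sqrt (real r)})
    \<le> (\<Sum>(r, p, q)\<in>(SIGMA r:?I. ?Q r \<times> ?Q r). 2 * sqrt (real r) * real N / (real p * real q))"
  proof (rule card_UN_le_sum[where A = ?A])
    fix x assume x: "x \<in> (SIGMA r:?I. ?Q r \<times> ?Q r)"
    obtain r p q where xe: "x = (r, p, q)" by (cases x) auto
    have r: "r \<ge> 1" using x xe by auto
    show "real (card (?A x)) \<le> (\<lambda>(r, p, q). 2 * sqrt (real r) * real N / (real p * real q)) x"
    proof (cases "?A x = {}")
      case True
      show ?thesis unfolding True by (simp add: xe)
    next
      case False
      then have pq: "prime p" "prime q" "p \<noteq> q" "real p * real q \<le> real N * sqrt (real r)"
        by (auto simp: xe)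
      have pos: "p > 0" "q > 0" using pq prime_gt_0_nat by auto
      have "card (?A x) \<le> N div (p * q) + 1"
      proof (rule card_pairwise_cong_le)
        fix n n' assume n: "n \<in> ?A x" "n' \<in> ?A x"
        have "[n = n'] (mod p)" using n by (auto simp: xe Cong.cong_def)
        moreover have "[n + h = n' + h] (mod q)" using n by (auto simp: xe Cong.cong_def)
        then have "[n = n'] (mod q)" by (simp add: cong_add_rcancel_nat)
        ultimately show "[n = n'] (mod (p * q))"
          using primes_coprime[OF pq(1-3)] by (simp add: coprime_cong_mult_nat)
      qed (use pos in auto)
      then have "real (card (?A x)) \<le> real (N div (p * q)) + 1" by linarith
      also have "\<dots> \<le> real N / (real p * real q) + 1"
        using real_div_bounds(1)[of "p * q" N] pos by simp
      also have "\<dots> \<le> sqrt (real r) * real N / (real p * real q) + sqrt (real r) * real N / (real p * real q)"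
      proof (rule add_mono)
        show "real N / (real p * real q) \<le> sqrt (real r) * real N / (real p * real q)"
          using r mult_right_mono[of 1 "sqrt (real r)" "real N"] by (intro divide_right_mono) auto
        show "1 \<le> sqrt (real r) * real N / (real p * real q)"
          using pq pos by (simp add: field_simps)
      qed
      also have "\<dots> = 2 * sqrt (real r) * real N / (real p * real q)" by simp
      finally show ?thesis unfolding xe prod.case .
    qed
  next
    show "{n \<in> {1..N}. \<exists>r p q. L < real r \<and> prime p \<and> prime q \<and> p \<noteq> q \<and> r dvd p + 1 \<and> r dvd q + 1
      \<and> p dvd n \<and> q dvd n + h \<and> real p * real q \<le> real N * sqrt (real r)}
      \<subseteq> (\<Union>x\<in>(SIGMA r:?I. ?Q r \<times> ?Q r). ?A x)"
    proof
      fix n assume "n \<in> {n \<in> {1..N}. \<exists>r p q. L < real r \<and> prime p \<and> prime q \<and> p \<noteq> q \<and> r dvd p + 1 \<and> r dvd q + 1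
        \<and> p dvd n \<and> q dvd n + h \<and> real p * real q \<le> real N * sqrt (real r)}"
      then obtain r p q where n: "n \<in> {1..N}" and rpq: "L < real r" "prime p" "prime q" "p \<noteq> q"
        "r dvd p + 1" "r dvd q + 1" "p dvd n" "q dvd n + h" "real p * real q \<le> real N * sqrt (real r)" by auto
      have "p \<le> n" "q \<le> n + h" using rpq n by (auto intro!: dvd_imp_le)
      moreover have "r \<le> p + 1" using rpq by (intro dvd_imp_le) auto
      moreover have "p \<ge> 1" "q \<ge> 1" using rpq prime_ge_1_nat by auto
      moreover have "r \<ge> 1" using rpq assms by (cases "r = 0") auto
      ultimately have "(r, p, q) \<in> (SIGMA r:?I. ?Q r \<times> ?Q r)" using rpq n assms by auto
      moreover have "n \<in> ?A (r, p, q)" using n rpq by blast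
      ultimately show "n \<in> (\<Union>x\<in>(SIGMA r:?I. ?Q r \<times> ?Q r). ?A x)" by blast
    qed
  qed auto
  also have "\<dots> = (\<Sum>r\<in>?I. \<Sum>(p, q)\<in>?Q r \<times> ?Q r. 2 * sqrt (real r) * real N / (real p * real q))"
    by (subst sum.Sigma) (auto simp: case_prod_unfold)
  also have "\<dots> = (\<Sum>r\<in>?I. 2 * sqrt (real r) * real N * (\<Sum>q\<in>?Q r. 1 / real q)\<^sup>2)"
    unfolding power2_eq_square sum_product sum.cartesian_product
    by (simp add: case_prod_unfold sum_distrib_left)
  also have "\<dots> \<le> (\<Sum>r\<in>?I. 8 * real N * (harm (2 * N))\<^sup>2 * (1 / (real r * sqrt (real r))))"
  proof (rule sum_mono)
    fix r assume r: "r \<in> ?I"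
    have "(\<Sum>q\<in>?Q r. 1 / real q) \<le> 2 / real r * harm (2 * N)"
      using r assms by (intro sum_inverse_minus_one_class) auto
    then have "(\<Sum>q\<in>?Q r. 1 / real q)\<^sup>2 \<le> (2 / real r * harm (2 * N))\<^sup>2"
      by (intro power_mono sum_nonneg) auto
    then have "2 * sqrt (real r) * real N * (\<Sum>q\<in>?Q r. 1 / real q)\<^sup>2
      \<le> 2 * sqrt (real r) * real N * (2 / real r * harm (2 * N))\<^sup>2" by (intro mult_left_mono) auto
    also have "\<dots> = 8 * real N * (harm (2 * N))\<^sup>2 * (sqrt (real r) / (real r * real r))"
      by (simp add: power2_eq_square)
    also have "sqrt (real r) / (real r * real r) = 1 / (real r * sqrt (real r))"
    proof -
      have "sqrt (real r) * sqrt (real r) = real r" by simp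
      then show ?thesis using r by (auto simp: divide_simps)
    qed
    finally show "2 * sqrt (real r) * real N * (\<Sum>q\<in>?Q r. 1 / real q)\<^sup>2
      \<le> 8 * real N * (harm (2 * N))\<^sup>2 * (1 / (real r * sqrt (real r)))" .
  qed
  also have "\<dots> = 8 * real N * (harm (2 * N))\<^sup>2 * (\<Sum>r\<in>?I. 1 / (real r * sqrt (real r)))"
    by (simp add: sum_distrib_left)
  also have "\<dots> \<le> 8 * real N * (harm (2 * N))\<^sup>2 * (3 / sqrt L)"
    using assms by (intro mult_left_mono sum_inverse_sqrt_cube_tail) auto
  finally show ?thesis by simp
qed

text \<open>From n = a p with p = -1 modulo r, n is determined modulo a r; from b | n + h, it is
  determined modulo b. If there is such an n at all, then r does not divide b, so gcd (a r) b = gcd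
  a b, and this divides h. Hence the lcm is at least a b r / h. The hypothesis \<open>small\<close>
  absorbs the rounding error, at the price of replacing r by sqrt r.\<close>

lemma card_cofactor_class_le:
  fixes a b r h N :: nat
  assumes r: "prime r" and ab: "a > 0" "b > 0" and h: "h > 0"
    and small: "real a * real b * sqrt (real r) \<le> 2 * real N"
  shows "real (card {n \<in> {1..N}. \<exists>p q. n = a * p \<and> n + h = b * q \<and> r dvd p + 1 \<and> r dvd q + 1 \<and> \<not> r dvd n + h})
    \<le> 3 * real h * real N / (real a * real b * sqrt (real r))"
proof (cases "{n \<in> {1..N}. \<exists>p q. n = a * p \<and> n + h = b * q \<and> r dvd p + 1 \<and> r dvd q + 1 \<and> \<not> r dvd n + h} = {}")
  case True
  show ?thesis unfolding True by simp
next
  case False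
  let ?S = "{n \<in> {1..N}. \<exists>p q. n = a * p \<and> n + h = b * q \<and> r dvd p + 1 \<and> r dvd q + 1 \<and> \<not> r dvd n + h}"
  obtain n where n: "n \<in> ?S" using False by blast
  have r1: "real r \<ge> 1" using prime_ge_1_nat[OF r] by simp
  have "\<not> r dvd b" using n by auto
  then have "coprime b r" using r prime_imp_coprime coprime_commute by blast
  then have gcd: "gcd (a * r) b = gcd a b" by (rule gcd_mult_left_right_cancel)
  have "gcd a b dvd n" "gcd a b dvd n + h" using n by auto
  then have "gcd a b dvd h" using dvd_add_right_iff by blast
  then have "gcd a b \<le> h" using h by (rule dvd_imp_le)
  define l where "l = lcm (a * r) b"
  have l: "l > 0" using ab prime_gt_0_nat[OF r] by (simp add: l_def lcm_pos_nat)
  have "gcd a b * l = a * r * b" unfolding l_def gcd[symmetric] by (rule prod_gcd_lcm_nat[symmetric])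
  then have "a * r * b \<le> h * l" using \<open>gcd a b \<le> h\<close> by (metis mult_le_mono1)
  then have abl: "real a * real r * real b \<le> real h * real l" by (metis of_nat_le_iff of_nat_mult)
  have "card ?S \<le> N div l + 1"
  proof (rule card_pairwise_cong_le[OF l])
    fix n n' assume n: "n \<in> ?S" "n' \<in> ?S"
    obtain p p' where p: "n = a * p" "n' = a * p'" "r dvd p + 1" "r dvd p' + 1" using n by auto
    have "[p + 1 = p' + 1] (mod r)" using p by (simp add: Cong.cong_def)
    then have "[p = p'] (mod r)" by (simp only: cong_add_rcancel_nat)
    then have "[n = n'] (mod (a * r))" unfolding p by (rule cong_cmult_leftI)
    moreover have "[n + h = n' + h] (mod b)" using n by (auto simp: Cong.cong_def)
    then have "[n = n'] (mod b)" by (simp add: cong_add_rcancel_nat)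
    ultimately show "[n = n'] (mod l)" unfolding l_def by (rule cong_cong_lcm_nat)
  qed auto
  then have "real (card ?S) \<le> real (N div l) + 1" by linarith
  also have "\<dots> \<le> real N / real l + 1" using real_div_bounds(1)[OF l] by simp
  also have "real N / real l \<le> real h * real N / (real a * real b * sqrt (real r))"
  proof -
    have "real r \<le> real r * real r" using r1 by (simp flip: of_nat_mult)
    then have "sqrt (real r) \<le> sqrt (real r * real r)" by (rule real_sqrt_le_mono)
    then have "real a * real b * sqrt (real r) \<le> real a * real b * real r" by (intro mult_left_mono) auto
    also have "\<dots> \<le> real h * real l" using abl by (simp add: mult_ac)
    finally have "real N * (real a * real b * sqrt (real r)) \<le> real N * (real h * real l)"
      by (rule mult_left_mono) simp
    then show ?thesis using l ab r1 by (simp add: field_simps)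
  qed
  also have "1 \<le> 2 * real h * real N / (real a * real b * sqrt (real r))"
  proof -
    have "real a * real b * sqrt (real r) \<le> 2 * real N * 1" using small by simp
    also have "\<dots> \<le> 2 * real N * real h" using h by (intro mult_left_mono) auto
    finally show ?thesis using ab r1 by (simp add: field_simps)
  qed
  finally show ?thesis by (simp add: add_divide_distrib[symmetric] algebra_simps)
qed

text \<open>Multiplying n = a p by n + h = b q and using that p q is large gives a b sqrt r \<le> 2
  N, which is the smallness needed for the count of one class. The congruence a = b + h modulo r
  saves r in the sum over pairs, the count itself saves sqrt r.\<close>

lemma card_nondegenerate_le:
  fixes L :: real
  assumes "L \<ge> 2" "L \<ge> 2 * real h" "h \<le> N" "h > 0"
  shows "real (card {n \<in> {1..N}. \<exists>r a b p q. L < real r \<and> prime r \<and> n = a * p \<and> n + h = b * q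
      \<and> r dvd p + 1 \<and> r dvd q + 1 \<and> \<not> r dvd n + h \<and> a \<noteq> b + h \<and> real N * sqrt (real r) < real p * real q})
    \<le> 27 * real h * real N * (harm (2 * N))\<^sup>2 / sqrt L"
proof -
  let ?I = "{r \<in> {1..2 * N}. L < real r}"
  let ?P = "\<lambda>r. {(a, b) \<in> {1..2 * N} \<times> {1..2 * N}. [a = b + h] (mod r) \<and> a \<noteq> b + h}"
  let ?A = "\<lambda>x. {n \<in> {1..N}. \<exists>r a b p q. x = (r, a, b) \<and> prime r \<and> n = a * p \<and> n + h = b * q
      \<and> r dvd p + 1 \<and> r dvd q + 1 \<and> \<not> r dvd n + h \<and> real a * real b * sqrt (real r) \<le> 2 * real N}"
  have finP: "finite (?P r)" for r by (rule finite_subset[of _ "{1..2 * N} \<times> {1..2 * N}"]) auto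
  have "real (card {n \<in> {1..N}. \<exists>r a b p q. L < real r \<and> prime r \<and> n = a * p \<and> n + h = b * q
      \<and> r dvd p + 1 \<and> r dvd q + 1 \<and> \<not> r dvd n + h \<and> a \<noteq> b + h \<and> real N * sqrt (real r) < real p * real q})
    \<le> (\<Sum>(r, a, b)\<in>Sigma ?I ?P. 3 * real h * real N / (real a * real b * sqrt (real r)))"
  proof (rule card_UN_le_sum[where A = ?A])
    fix x assume x: "x \<in> Sigma ?I ?P"
    obtain r a b where xe: "x = (r, a, b)" by (cases x) auto
    have ab: "a > 0" "b > 0" using x xe by auto
    show "real (card (?A x)) \<le> (\<lambda>(r, a, b). 3 * real h * real N / (real a * real b * sqrt (real r))) x"
    proof (cases "?A x = {}")
      case True
      show ?thesis unfolding True by (simp add: xe)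
    next
      case False
      then have r: "prime r" "real a * real b * sqrt (real r) \<le> 2 * real N" by (auto simp: xe)
      have "?A x = {n \<in> {1..N}. \<exists>p q. n = a * p \<and> n + h = b * q \<and> r dvd p + 1 \<and> r dvd q + 1 \<and> \<not> r dvd n + h}"
        using r by (auto simp: xe)
      then show ?thesis using card_cofactor_class_le[OF r(1) ab assms(4) r(2)] by (simp add: xe)
    qed
  next
    show "{n \<in> {1..N}. \<exists>r a b p q. L < real r \<and> prime r \<and> n = a * p \<and> n + h = b * q
      \<and> r dvd p + 1 \<and> r dvd q + 1 \<and> \<not> r dvd n + h \<and> a \<noteq> b + h \<and> real N * sqrt (real r) < real p * real q}
      \<subseteq> (\<Union>x\<in>Sigma ?I ?P. ?A x)"
    proof
      fix n assume "n \<in> {n \<in> {1..N}. \<exists>r a b p q. L < real r \<and> prime r \<and> n = a * p \<and> n + h = b * q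
      \<and> r dvd p + 1 \<and> r dvd q + 1 \<and> \<not> r dvd n + h \<and> a \<noteq> b + h \<and> real N * sqrt (real r) < real p * real q}"
      then obtain r a b p q where n: "n \<in> {1..N}" and *: "L < real r" "prime r" "n = a * p" "n + h = b * q"
        "r dvd p + 1" "r dvd q + 1" "\<not> r dvd n + h" "a \<noteq> b + h" "real N * sqrt (real r) < real p * real q" by blast
      have pos: "a > 0" "p > 0" "b > 0" "q > 0" using n * by (auto intro!: gr0I)
      have "a \<le> n" "p \<le> n" "b \<le> n + h" using *(3,4) pos by simp_all
      moreover have "1 \<le> n" "n \<le> N" using n by auto
      moreover have "r \<le> p + 1" using *(5) by (intro dvd_imp_le) auto
      ultimately have "a \<le> 2 * N" "b \<le> 2 * N" "r \<le> 2 * N" using assms(3) by linarith+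
      moreover have "r \<ge> 1" using *(2) by (rule prime_ge_1_nat)
      moreover have "[a = b + h] (mod r)"
      proof -
        \<comment> \<open>The relation a p + h = b q rearranged without subtraction; modulo r the
          two products vanish.\<close>
        have "a * (p + 1) + (b + h) = b * (q + 1) + a" using *(3,4) by (simp add: algebra_simps)
        moreover have "[a * (p + 1) + (b + h) = 0 + (b + h)] (mod r)"
          using *(5) by (intro cong_add cong_refl) (simp only: cong_0_iff dvd_mult)
        moreover have "[b * (q + 1) + a = 0 + a] (mod r)"
          using *(6) by (intro cong_add cong_refl) (simp only: cong_0_iff dvd_mult)
        ultimately show ?thesis by (metis add_0 cong_sym cong_trans)
      qed
      ultimately have "(r, a, b) \<in> Sigma ?I ?P" using *(1,8) pos by auto
      moreover have "real a * real b * sqrt (real r) \<le> 2 * real N"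
      proof -
        have N: "real N > 0" using n by auto
        have "real N * (real a * real b * sqrt (real r)) = real a * real b * (real N * sqrt (real r))" by simp
        also have "\<dots> \<le> real a * real b * (real p * real q)" using * by (intro mult_left_mono) auto
        also have "\<dots> = real (a * p) * real (b * q)" by simp
        also have "\<dots> = real n * real (n + h)" using * by simp
        also have "\<dots> \<le> real N * (2 * real N)" using n assms by (intro mult_mono) auto
        finally show ?thesis using N by simp
      qed
      then have "n \<in> ?A (r, a, b)" using n * by blast
      ultimately show "n \<in> (\<Union>x\<in>Sigma ?I ?P. ?A x)" by (rule UN_I[where B = ?A and a = "(r, a, b)"])
    qed
  qed (use finP in auto)
  also have "\<dots> = (\<Sum>r\<in>?I. \<Sum>(a, b)\<in>?P r. 3 * real h * real N / (real a * real b * sqrt (real r)))"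
    using finP by (subst sum.Sigma) (auto simp: case_prod_unfold)
  also have "\<dots> = (\<Sum>r\<in>?I. 3 * real h * real N / sqrt (real r) * (\<Sum>(a, b)\<in>?P r. 1 / (real a * real b)))"
    by (simp add: sum_distrib_left case_prod_unfold mult.commute)
  also have "\<dots> \<le> (\<Sum>r\<in>?I. 9 * real h * real N * (harm (2 * N))\<^sup>2 * (1 / (real r * sqrt (real r))))"
  proof (rule sum_mono)
    fix r assume r: "r \<in> ?I"
    have "real (2 * h) < real r" using r assms by simp
    then have "2 * h \<le> r" by linarith
    moreover have "2 \<le> r" using r assms by simp
    ultimately have "(\<Sum>(a, b)\<in>?P r. 1 / (real a * real b)) \<le> 3 * (harm (2 * N))\<^sup>2 / real r"
      by (intro sum_inverse_pairs_cong[where h = h]) auto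
    then have "3 * real h * real N / sqrt (real r) * (\<Sum>(a, b)\<in>?P r. 1 / (real a * real b))
      \<le> 3 * real h * real N / sqrt (real r) * (3 * (harm (2 * N))\<^sup>2 / real r)"
      by (intro mult_left_mono) auto
    also have "\<dots> = 9 * real h * real N * (harm (2 * N))\<^sup>2 * (1 / (real r * sqrt (real r)))"
      by (simp add: mult_ac)
    finally show "3 * real h * real N / sqrt (real r) * (\<Sum>(a, b)\<in>?P r. 1 / (real a * real b))
      \<le> 9 * real h * real N * (harm (2 * N))\<^sup>2 * (1 / (real r * sqrt (real r)))" .
  qed
  also have "\<dots> = 9 * real h * real N * (harm (2 * N))\<^sup>2 * (\<Sum>r\<in>?I. 1 / (real r * sqrt (real r)))"
    by (simp add: sum_distrib_left)
  also have "\<dots> \<le> 9 * real h * real N * (harm (2 * N))\<^sup>2 * (3 / sqrt L)"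
    using assms by (intro mult_left_mono sum_inverse_sqrt_cube_tail) auto
  finally show ?thesis by simp
qed

section \<open>The degenerate case and the case distinction\<close>

text \<open>For k the number of prime factors of Q, 2^k \<le> Q \<le> (2 h b)^2 gives 2 powr (k / 4)
  \<le> sqrt (2 h b). The exponent 1/4 makes the sieve's factor cost only sqrt b against the 1 / b^2
  in the range of t.\<close>

lemma square_le_two_powr: "\<exists>C \<ge> 0. \<forall>k::nat. (real k + 1)\<^sup>2 \<le> C * 2 powr (real k / 4)"
proof -
  have "(\<lambda>k::nat. (real k + 1)\<^sup>2 / 2 powr (real k / 4)) \<longlonglongrightarrow> 0" by real_asymp
  then have "Bseq (\<lambda>k::nat. (real k + 1)\<^sup>2 / 2 powr (real k / 4))"
    by (intro convergent_imp_Bseq) (auto simp: convergent_def)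
  then obtain C where C: "C > 0" "\<And>k::nat. norm ((real k + 1)\<^sup>2 / 2 powr (real k / 4)) \<le> C"
    by (auto elim: BseqE)
  have "(real k + 1)\<^sup>2 \<le> C * 2 powr (real k / 4)" for k :: nat
    using C(2)[of k] by (simp add: field_simps)
  then show ?thesis using C(1) less_imp_le by blast
qed

text \<open>Adding b to (b + h) p + h = b q gives (b + h) (p + 1) = b (q + 1). After division by gcd
  b h the coefficients \<beta> and \<alpha> are coprime, so \<alpha> divides p + 1 and t is the
  quotient. Since (b + h) (p + 1) \<le> 2 N and gcd b h \<le> h, it follows that t b^2 \<le> 2 h
  N.\<close>

lemma card_degenerate_class_le:
  fixes b h N :: nat
  assumes b: "b > 0" and h: "h > 0"
  defines "\<alpha> \<equiv> b div gcd b h" and "\<beta> \<equiv> (b + h) div gcd b h"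
  shows "card {n \<in> {1..N}. \<exists>p q. prime p \<and> prime q \<and> n = (b + h) * p \<and> n + h = b * q}
    \<le> card {t \<in> {1..2 * h * N div (b * b)}. prime (\<alpha> * t - 1) \<and> prime (\<beta> * t - 1)}"
proof -
  define g where "g = gcd b h"
  have g: "g > 0" "g dvd b" "g dvd b + h" "g \<le> h" using b h by (auto simp: g_def)
  have \<alpha>: "b = g * \<alpha>" and \<beta>: "b + h = g * \<beta>"
    using g unfolding \<alpha>_def \<beta>_def g_def[symmetric] by simp_all
  have "gcd b (b + h) = g" by (simp add: g_def)
  then have cop: "coprime \<alpha> \<beta>"
    unfolding \<alpha>_def \<beta>_def g_def[symmetric] using div_gcd_coprime[of b "b + h"] b by simp
  have \<alpha>0: "\<alpha> > 0" using \<alpha> b by (cases "\<alpha> = 0") auto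
  let ?T = "{t \<in> {1..2 * h * N div (b * b)}. prime (\<alpha> * t - 1) \<and> prime (\<beta> * t - 1)}"
  have "{n \<in> {1..N}. \<exists>p q. prime p \<and> prime q \<and> n = (b + h) * p \<and> n + h = b * q}
    \<subseteq> (\<lambda>t. (b + h) * (\<alpha> * t - 1)) ` ?T"
  proof
    fix n assume "n \<in> {n \<in> {1..N}. \<exists>p q. prime p \<and> prime q \<and> n = (b + h) * p \<and> n + h = b * q}"
    then obtain p q where n: "n \<in> {1..N}" and pq: "prime p" "prime q" "n = (b + h) * p" "n + h = b * q" by auto
    have "(b + h) * (p + 1) = b * (q + 1)" using pq(3,4) by (simp add: algebra_simps)
    then have "g * (\<beta> * (p + 1)) = g * (\<alpha> * (q + 1))" unfolding \<alpha>[symmetric] \<beta>[symmetric]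
      by (simp only: mult.assoc[symmetric] \<alpha>[symmetric] \<beta>[symmetric])
    then have eq: "\<beta> * (p + 1) = \<alpha> * (q + 1)" using g(1) by (simp only: mult_left_cancel)
    then have "\<alpha> dvd \<beta> * (p + 1)" by simp
    then have "\<alpha> dvd p + 1" using cop coprime_dvd_mult_right_iff by blast
    then obtain t where t: "p + 1 = \<alpha> * t" by blast
    have "\<alpha> * (q + 1) = \<alpha> * (\<beta> * t)" unfolding eq[symmetric] t by (simp only: mult_ac)
    then have t': "q + 1 = \<beta> * t" using \<alpha>0 by (simp only: mult_left_cancel)
    have t0: "t > 0" using t by (cases "t = 0") auto
    have p: "p = \<alpha> * t - 1" and q: "q = \<beta> * t - 1" using t t' by simp_all
    have "b + h \<le> n" using pq(3) prime_gt_0_nat[OF pq(1)] by simp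
    then have "(b + h) * (p + 1) \<le> 2 * N" using pq(3) n by (simp add: algebra_simps)
    then have le: "g * ((b + h) * (\<alpha> * t)) \<le> h * (2 * N)"
      unfolding t[symmetric] by (intro mult_le_mono[OF g(4)])
    have "t * (b * b) \<le> b * (b + h) * t" by (simp add: algebra_simps)
    also have "\<dots> = g * ((b + h) * (\<alpha> * t))" using \<alpha> by (metis mult.assoc mult.commute)
    also note le
    finally have "t * (b * b) \<le> 2 * h * N" by (simp only: mult_ac)
    then have "t \<le> 2 * h * N div (b * b)" using b by (simp add: less_eq_div_iff_mult_less_eq)
    then have "t \<in> ?T" using t0 pq p q by auto
    then show "n \<in> (\<lambda>t. (b + h) * (\<alpha> * t - 1)) ` ?T" using pq(3) p by blast
  qed
  then show ?thesis by (rule surj_card_le[rotated]) simp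
qed

text \<open>The sieve is applied for b \<le> M only, because its remainder U^12 does not decrease
  with b. For larger b the trivial count of t suffices, its sum over b > M being small.\<close>

lemma card_degenerate_le:
  fixes h :: nat
  assumes h: "h > 0"
  shows "\<exists>C \<ge> 0. \<forall>N U M. h \<le> N \<and> 2 \<le> U \<and> 1 \<le> M \<longrightarrow>
    real (card {n \<in> {1..N}. \<exists>b p q. prime p \<and> prime q \<and> n = (b + h) * p \<and> n + h = b * q})
      \<le> C * (real N / (ln (real U))\<^sup>2) + real M * (real U ^ 12 + real U + 1) + C * (real N / sqrt (real M))"
proof -
  obtain C0 where C0: "C0 \<ge> 0" "\<And>k::nat. (real k + 1)\<^sup>2 \<le> C0 * 2 powr (real k / 4)"
    using square_le_two_powr by blast
  define C1 where "C1 = 2 * real h * C0 * sqrt (2 * real h)"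
  define C where "C = max (3 * C1) (6 * real h)"
  have C1: "C1 \<ge> 0" using C0 by (simp add: C1_def)
  have "real (card {n \<in> {1..N}. \<exists>b p q. prime p \<and> prime q \<and> n = (b + h) * p \<and> n + h = b * q})
      \<le> C * (real N / (ln (real U))\<^sup>2) + real M * (real U ^ 12 + real U + 1) + C * (real N / sqrt (real M))"
    if N: "h \<le> N" and U: "2 \<le> U" and M: "1 \<le> M" for N U M
  proof -
    define e where "e = real U ^ 12 + real U + 1"
    define A where "A = (\<lambda>b. {n \<in> {1..N}. \<exists>p q. prime p \<and> prime q \<and> n = (b + h) * p \<and> n + h = b * q})"
    define w where "w = (\<lambda>b::nat. 1 / (real b * sqrt (real b)))"
    have lnU: "ln (real U) > 0" using U by simp
    have small: "real (card (A b)) \<le> C1 * (real N / (ln (real U))\<^sup>2) * w b + e" if b: "b > 0" for b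
    proof -
      define \<alpha> where "\<alpha> = b div gcd b h"
      define \<beta> where "\<beta> = (b + h) div gcd b h"
      define T where "T = 2 * h * N div (b * b)"
      define Q where "Q = 2 * \<alpha> * \<beta> * (\<beta> - \<alpha>)"
      define k where "k = card (prime_factors Q)"
      have gpos: "gcd b h > 0" using b by simp
      have \<alpha>: "b = gcd b h * \<alpha>" and \<beta>: "b + h = gcd b h * \<beta>"
        unfolding \<alpha>_def \<beta>_def by (rule dvd_mult_div_cancel[symmetric], simp)+
      have "gcd b h * \<alpha> < gcd b h * \<beta>" using \<alpha> \<beta> h by linarith
      then have lt: "\<alpha> < \<beta>" by simp
      have \<alpha>0: "\<alpha> > 0" using \<alpha> b by (cases "\<alpha> = 0") auto
      have le: "\<alpha> \<le> b" "\<beta> \<le> b + h" unfolding \<alpha>_def \<beta>_def by (rule div_le_dividend)+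
      have "gcd b h * (\<beta> - \<alpha>) = h" using \<alpha> \<beta> by (simp add: diff_mult_distrib2)
      then have le': "\<beta> - \<alpha> \<le> h" using gpos by (metis mult_le_mono1 mult_1 Suc_leI One_nat_def)
      have "b + h \<le> b * (2 * h)"
      proof -
        have "b \<le> b * h" "h \<le> b * h" using b h by simp_all
        then have "b + h \<le> b * h + b * h" by (rule add_mono)
        then show ?thesis by (simp only: mult_2 distrib_left)
      qed
      \<comment> \<open>From \<alpha> \<le> b, \<beta> \<le> b + h \<le> 2 h b and \<beta> -
        \<alpha> \<le> h; the product equals (2 h b)^2.\<close>
      then have "Q \<le> 2 * b * (b * (2 * h)) * h"
        unfolding Q_def using le le' by (intro mult_le_mono) auto
      then have Qle: "Q \<le> (2 * h * b)\<^sup>2" by (simp add: power2_eq_square mult_ac)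
      have Q0: "Q > 0" using \<alpha>0 lt by (simp add: Q_def)
      have "2 ^ k \<le> \<Prod>(prime_factors Q)"
        unfolding k_def by (intro two_power_card_le_prod) (auto intro: prime_ge_2_nat in_prime_factors_imp_prime)
      also have "\<dots> \<le> Q"
      proof (rule dvd_imp_le[OF _ Q0])
        have "\<Prod>(prime_factors Q) dvd (\<Prod>p\<in>prime_factors Q. p ^ multiplicity p Q)"
          by (rule prod_dvd_prod) (auto simp: prime_factors_multiplicity)
        then show "\<Prod>(prime_factors Q) dvd Q" using Q0 by (simp add: prod_prime_factors)
      qed
      also note Qle
      finally have "real (2 ^ k) \<le> real ((2 * h * b)\<^sup>2)" by (rule of_nat_mono)
      then have "(2 ^ k :: real) \<le> (2 * real h * real b)\<^sup>2" by simp
      then have "((2::real) ^ k) powr (1 / 4) \<le> ((2 * real h * real b)\<^sup>2) powr (1 / 4)"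
        by (intro powr_mono2) auto
      moreover have "((2::real) ^ k) powr (1 / 4) = 2 powr (real k / 4)"
        by (simp add: powr_powr flip: powr_realpow)
      moreover have "((2 * real h * real b)\<^sup>2) powr (1 / 4) = sqrt (2 * real h * real b)"
      proof -
        have sq: "(2 * real h * real b)\<^sup>2 = (2 * real h * real b) powr 2" using b h by simp
        show ?thesis unfolding sq powr_powr using b h by (simp add: powr_half_sqrt)
      qed
      ultimately have "2 powr (real k / 4) \<le> sqrt (2 * real h * real b)" by simp
      then have "C0 * 2 powr (real k / 4) \<le> C0 * sqrt (2 * real h * real b)"
        using C0(1) by (rule mult_left_mono)
      then have kk: "(real k + 1)\<^sup>2 \<le> C0 * sqrt (2 * real h * real b)" using C0(2)[of k] by linarith
      have T: "real T \<le> 2 * real h * real N / (real b * real b)"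
        unfolding T_def using real_div_bounds(1)[of "b * b" "2 * h * N"] b by simp
      have "real T * (real k + 1)\<^sup>2
        \<le> 2 * real h * real N / (real b * real b) * (C0 * sqrt (2 * real h * real b))"
        using T kk by (intro mult_mono) auto
      also have "\<dots> = C1 * real N * (sqrt (real b) / (real b * real b))"
        by (simp add: C1_def real_sqrt_mult)
      also have "sqrt (real b) / (real b * real b) = w b"
      proof -
        have "sqrt (real b) * sqrt (real b) = real b" by simp
        then show ?thesis using b by (auto simp: w_def divide_simps)
      qed
      finally have "real T * (real k + 1)\<^sup>2 / (ln (real U))\<^sup>2 \<le> C1 * real N * w b / (ln (real U))\<^sup>2"
        by (rule divide_right_mono) simp
      moreover have "real (card (A b)) \<le> real (card {t \<in> {1..T}. prime (\<alpha> * t - 1) \<and> prime (\<beta> * t - 1)})"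
        unfolding A_def T_def \<alpha>_def \<beta>_def using card_degenerate_class_le[OF b h] by (rule of_nat_mono)
      moreover have "\<dots> \<le> real T * (real k + 1)\<^sup>2 / (ln (real U))\<^sup>2 + real U ^ 12 + real U + 1"
        unfolding k_def Q_def using \<alpha>0 lt U by (rule card_prime_pairs_le)
      ultimately show ?thesis by (simp add: e_def)
    qed
    have large: "real (card (A b)) \<le> 2 * real h * real N * w b" if b: "b > 0" for b
    proof -
      have "card (A b) \<le> card {1..2 * h * N div (b * b)}"
        unfolding A_def by (rule order_trans[OF card_degenerate_class_le[OF b h]]) (intro card_mono, auto)
      then have "real (card (A b)) \<le> real (2 * h * N div (b * b))" by simp
      also have "\<dots> \<le> real (2 * h * N) / real (b * b)" using b by (intro real_div_bounds) auto
      also have "\<dots> = 2 * real h * real N * (1 / (real b * real b))" by simp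
      also have "\<dots> \<le> 2 * real h * real N * w b"
      proof -
        have "real b \<le> real b * real b" using b by (simp flip: of_nat_mult)
        then have "sqrt (real b) \<le> sqrt (real b * real b)" by (rule real_sqrt_le_mono)
        then have "real b * sqrt (real b) \<le> real b * real b" by (intro mult_left_mono) auto
        then show ?thesis using b unfolding w_def by (intro mult_left_mono divide_left_mono) auto
      qed
      finally show ?thesis .
    qed
    have "real (card {n \<in> {1..N}. \<exists>b p q. prime p \<and> prime q \<and> n = (b + h) * p \<and> n + h = b * q})
      \<le> (\<Sum>b\<in>{1..2 * N}. if b \<le> M then C1 * (real N / (ln (real U))\<^sup>2) * w b + e else 2 * real h * real N * w b)"
    proof (rule card_UN_le_sum[where A = A])
      show "{n \<in> {1..N}. \<exists>b p q. prime p \<and> prime q \<and> n = (b + h) * p \<and> n + h = b * q} \<subseteq> (\<Union>b\<in>{1..2 * N}. A b)"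
      proof
        fix n assume "n \<in> {n \<in> {1..N}. \<exists>b p q. prime p \<and> prime q \<and> n = (b + h) * p \<and> n + h = b * q}"
        then obtain b p q where n: "n \<in> {1..N}" "prime p" "prime q" "n = (b + h) * p" "n + h = b * q" by auto
        have "b \<noteq> 0" using n h by (intro notI) simp
        moreover have "b \<le> n + h" unfolding n(5) using prime_gt_0_nat[OF n(3)] by simp
        ultimately have "b \<in> {1..2 * N}" using n(1) N by auto
        moreover have "n \<in> A b" using n by (auto simp: A_def)
        ultimately show "n \<in> (\<Union>b\<in>{1..2 * N}. A b)" by blast
      qed
    qed (use small large in \<open>auto simp: A_def\<close>)
    also have "\<dots> = (\<Sum>b | b \<in> {1..2 * N} \<and> b \<le> M. C1 * (real N / (ln (real U))\<^sup>2) * w b + e)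
        + (\<Sum>b | b \<in> {1..2 * N} \<and> \<not> b \<le> M. 2 * real h * real N * w b)"
      by (subst sum.If_cases) (auto simp: Int_def)
    also have "(\<Sum>b | b \<in> {1..2 * N} \<and> b \<le> M. C1 * (real N / (ln (real U))\<^sup>2) * w b + e)
       = C1 * (real N / (ln (real U))\<^sup>2) * (\<Sum>b | b \<in> {1..2 * N} \<and> b \<le> M. w b)
        + real (card {b. b \<in> {1..2 * N} \<and> b \<le> M}) * e"
      by (simp add: sum.distrib sum_distrib_left)
    also have "C1 * (real N / (ln (real U))\<^sup>2) * (\<Sum>b | b \<in> {1..2 * N} \<and> b \<le> M. w b)
      \<le> C1 * (real N / (ln (real U))\<^sup>2) * 3"
      unfolding w_def using C1 by (intro mult_left_mono sum_inverse_sqrt_cube_total) auto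
    also have "real (card {b. b \<in> {1..2 * N} \<and> b \<le> M}) * e \<le> real M * e"
    proof (rule mult_right_mono)
      have "card {b. b \<in> {1..2 * N} \<and> b \<le> M} \<le> card {1..M}" by (intro card_mono) auto
      then show "real (card {b. b \<in> {1..2 * N} \<and> b \<le> M}) \<le> real M" by simp
    qed (simp add: e_def)
    also have "(\<Sum>b | b \<in> {1..2 * N} \<and> \<not> b \<le> M. 2 * real h * real N * w b)
      = 2 * real h * real N * (\<Sum>b | b \<in> {1..2 * N} \<and> \<not> b \<le> M. w b)" by (simp add: sum_distrib_left)
    also have "\<dots> \<le> 2 * real h * real N * (3 / sqrt (real M))"
      unfolding w_def using M by (intro mult_left_mono sum_inverse_sqrt_cube_tail) auto
    finally have "real (card {n \<in> {1..N}. \<exists>b p q. prime p \<and> prime q \<and> n = (b + h) * p \<and> n + h = b * q})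
      \<le> 3 * C1 * (real N / (ln (real U))\<^sup>2) + real M * e + 6 * real h * (real N / sqrt (real M))" by (simp add: mult_ac)
    also have "3 * C1 * (real N / (ln (real U))\<^sup>2) \<le> C * (real N / (ln (real U))\<^sup>2)"
      by (intro mult_right_mono) (auto simp: C_def)
    also have "6 * real h * (real N / sqrt (real M)) \<le> C * (real N / sqrt (real M))"
      by (intro mult_right_mono) (auto simp: C_def)
    finally show ?thesis by (simp add: e_def)
  qed
  moreover have "C \<ge> 0" by (simp add: C_def max_def)
  ultimately show ?thesis by blast
qed

text \<open>Failure of the first three alternatives provides a prime p > y dividing n exactly once
  and a prime r > L dividing p + 1. Then r divides \<open>sigma n\<close>, hence
  \<open>sigma (n + h)\<close>, hence the value of \<open>sigma\<close> at some prime power q^e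
  dividing n + h. The next two alternatives force e = 1 and make r prime to n + h; the last three
  divide what remains. The form n + 0 matches the instance k = 0 of the count of square
  divisors.\<close>

lemma sigma_dvd_shift_cases:
  fixes y z L :: real
  assumes n: "n \<in> {1..N}" and dvd: "sigma n dvd sigma (n + h)" and h: "h > 0"
    and L: "L = 2 * z ^ 3" "L \<ge> real h + 1" and z: "z \<ge> 1"
  shows "(\<forall>p. prime p \<and> p dvd n \<longrightarrow> real p \<le> y)
    \<or> (\<exists>m. y < real m \<and> m * m dvd n + 0)
    \<or> (\<exists>p. prime p \<and> y < real p \<and> p dvd n \<and> (\<forall>r. prime r \<and> r dvd p + 1 \<longrightarrow> real r \<le> L))
    \<or> (\<exists>m. z < real m \<and> m * m dvd n + h)
    \<or> (\<exists>r q. L < real r \<and> r dvd q + 1 \<and> q dvd n + h \<and> r dvd n + h)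
    \<or> (\<exists>r p q. L < real r \<and> prime p \<and> prime q \<and> p \<noteq> q \<and> r dvd p + 1 \<and> r dvd q + 1
        \<and> p dvd n \<and> q dvd n + h \<and> real p * real q \<le> real N * sqrt (real r))
    \<or> (\<exists>r a b p q. L < real r \<and> prime r \<and> n = a * p \<and> n + h = b * q \<and> r dvd p + 1 \<and> r dvd q + 1
        \<and> \<not> r dvd n + h \<and> a \<noteq> b + h \<and> real N * sqrt (real r) < real p * real q)
    \<or> (\<exists>b p q. prime p \<and> prime q \<and> n = (b + h) * p \<and> n + h = b * q)"
proof (rule ccontr)
  assume neg: "\<not> ?thesis"
  note neg' = this[unfolded de_Morgan_disj]
  note no_smooth = neg'[THEN conjunct1]
  note no_square = neg'[THEN conjunct2, THEN conjunct1]
  note no_shift = neg'[THEN conjunct2, THEN conjunct2, THEN conjunct1]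
  note neg4 = neg'[THEN conjunct2, THEN conjunct2, THEN conjunct2]
  note no_square' = neg4[THEN conjunct1]
  note no_class = neg4[THEN conjunct2, THEN conjunct1]
  note no_C1 = neg4[THEN conjunct2, THEN conjunct2, THEN conjunct1]
  note no_C3 = neg4[THEN conjunct2, THEN conjunct2, THEN conjunct2, THEN conjunct1]
  note no_C2 = neg4[THEN conjunct2, THEN conjunct2, THEN conjunct2, THEN conjunct2]
  obtain p where p: "prime p" "p dvd n" "y < real p" using no_smooth by (auto simp: not_le)
  then have "\<not> (\<forall>r. prime r \<and> r dvd p + 1 \<longrightarrow> real r \<le> L)" using no_shift by blast
  then obtain r where r: "prime r" "r dvd p + 1" "L < real r" by (auto simp: not_le)
  have "\<not> p * p dvd n + 0" using no_square p(3) by blast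
  then have "\<not> p * p dvd n" by simp
  obtain a where a: "n = a * p" using p by (metis dvdE mult.commute)
  have "\<not> p dvd a" using \<open>\<not> p * p dvd n\<close> a by (auto simp: mult_dvd_mono)
  then have "coprime p a" using p prime_imp_coprime by blast
  moreover have "a > 0" using n a by (auto intro!: gr0I)
  ultimately have sn: "sigma n = (p + 1) * sigma a"
    using sigma_mult_coprime[of p a] sigma_prime[OF p(1)] prime_gt_0_nat[OF p(1)] by (simp add: a mult.commute)
  have "r dvd sigma n" unfolding sn using r(2) by (rule dvd_mult2)
  then have "r dvd sigma (n + h)" using dvd by (rule dvd_trans)
  then obtain q e where q: "prime q" "e > 0" "q ^ e dvd n + h" "r dvd sigma (q ^ e)"
    using prime_dvd_sigma[OF r(1), of "n + h"] h by auto
  \<comment> \<open>Here L = 2 z^3 is used: r < 2 q^e gives q^e > z^3. For e \<ge> 2 the exponent e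
    is at most three times e div 2, so m = q^(e div 2) satisfies m^3 > z^3, while m^2 divides n +
    h.\<close>
  have "e = 1"
  proof (rule ccontr)
    assume "e \<noteq> 1"
    define m where "m = q ^ (e div 2)"
    have "sigma (q ^ e) > 0" using sigma_prime_power[OF q(1), of e] by (simp add: sum.atMost_shift)
    then have "r \<le> sigma (q ^ e)" using q(4) by (rule dvd_imp_le[rotated])
    also have "\<dots> < 2 * q ^ e" by (rule sigma_prime_power_less[OF q(1)])
    also have "q ^ e \<le> q ^ (e div 2 * 3)"
      using \<open>e \<noteq> 1\<close> q(2) prime_ge_1_nat[OF q(1)] by (intro power_increasing) presburger+
    also have "\<dots> = m ^ 3" by (simp add: m_def power_mult)
    finally have "real r < real (2 * m ^ 3)" by (simp only: of_nat_less_iff)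
    then have "z ^ 3 < real m ^ 3" using r(3) L by simp
    then have "z < real m" by (rule power_less_imp_less_base) simp
    moreover have "m * m dvd q ^ e"
      unfolding m_def power_add[symmetric] by (rule le_imp_power_dvd) presburger
    then have "m * m dvd n + h" using q(3) by (rule dvd_trans)
    ultimately show False using no_square' by blast
  qed
  then have rq: "r dvd q + 1" and qn: "q dvd n + h" using q sigma_prime[OF q(1)] by simp_all
  obtain b where b: "n + h = b * q" using qn by (metis dvdE mult.commute)
  have nr: "\<not> r dvd n + h" using no_class rq qn r(3) by blast
  \<comment> \<open>A common prime would divide h, but p \<ge> r - 1 > L - 1 \<ge> h.\<close>
  have "p \<noteq> q"
  proof
    assume "p = q"
    then have "p dvd h" using p qn dvd_add_right_iff by blast
    then have "p \<le> h" using h by (rule dvd_imp_le)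
    moreover have "r \<le> p + 1" using r by (intro dvd_imp_le) auto
    ultimately show False using r(3) L(2) by linarith
  qed
  then have "\<not> real p * real q \<le> real N * sqrt (real r)"
    using no_C1 r(2,3) p(1,2) q(1) rq qn by blast
  then have "real N * sqrt (real r) < real p * real q" by simp
  moreover have "a \<noteq> b + h" using no_C2 p(1) q(1) a b by blast
  ultimately show False using no_C3 r a b rq nr by blast
qed

section \<open>The final estimate\<close>

text \<open>The union bound with all parameters free. Keeping it explicit confines the choice of
  parameters, and all asymptotics in N, to one later place.\<close>

lemma card_sigma_dvd_shift_le:
  fixes h :: nat
  assumes h: "h > 0"
  shows "\<exists>C \<ge> 0. \<forall>N U M (y::real) (z::real) (L::real). h \<le> N \<and> 2 \<le> U \<and> 1 \<le> M \<and> 1 < y \<and> 2 \<le> ln y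
      \<and> 1 \<le> z \<and> L = 2 * z ^ 3 \<and> 2 * real h + 2 \<le> L \<and> 2 \<le> ln L \<longrightarrow>
    real (card {n \<in> {1..N}. sigma n dvd sigma (n + h)}) \<le>
      (sqrt (real N) + real N * exp (- ln (sqrt (real N)) / ln y + 12 * ln y))
      + 6 * real N / sqrt y + 4 * real N * exp (- ln y / ln L + 12 * ln L)
      + 6 * real N / sqrt z + 12 * real N * harm (2 * N) / sqrt L
      + 24 * real N * (harm (2 * N))\<^sup>2 / sqrt L + 27 * real h * real N * (harm (2 * N))\<^sup>2 / sqrt L
      + (C * (real N / (ln (real U))\<^sup>2) + real M * (real U ^ 12 + real U + 1) + C * (real N / sqrt (real M)))"
proof -
  obtain C where C: "C \<ge> 0" "\<And>N U M. h \<le> N \<and> 2 \<le> U \<and> 1 \<le> M \<longrightarrow>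
    real (card {n \<in> {1..N}. \<exists>b p q. prime p \<and> prime q \<and> n = (b + h) * p \<and> n + h = b * q})
      \<le> C * (real N / (ln (real U))\<^sup>2) + real M * (real U ^ 12 + real U + 1) + C * (real N / sqrt (real M))"
    using card_degenerate_le[OF h] by blast
  have "real (card {n \<in> {1..N}. sigma n dvd sigma (n + h)}) \<le>
      (sqrt (real N) + real N * exp (- ln (sqrt (real N)) / ln y + 12 * ln y))
      + 6 * real N / sqrt y + 4 * real N * exp (- ln y / ln L + 12 * ln L)
      + 6 * real N / sqrt z + 12 * real N * harm (2 * N) / sqrt L
      + 24 * real N * (harm (2 * N))\<^sup>2 / sqrt L + 27 * real h * real N * (harm (2 * N))\<^sup>2 / sqrt L
      + (C * (real N / (ln (real U))\<^sup>2) + real M * (real U ^ 12 + real U + 1) + C * (real N / sqrt (real M)))"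
    if N: "h \<le> N" and U: "2 \<le> U" and M: "1 \<le> M" and y: "1 < y" "2 \<le> ln y" and z: "1 \<le> z"
      and L: "L = 2 * z ^ 3" "2 * real h + 2 \<le> L" "2 \<le> ln L" for N U M and y z L :: real
  proof -
    have N0: "sqrt (real N) > 0" using N h by simp
    have L2: "L \<ge> 2" "L > 1" "L \<ge> 2 * real h" "L \<ge> real h + 1" using L(2) by auto
    define E where "E = [{n \<in> {1..N}. \<forall>p. prime p \<and> p dvd n \<longrightarrow> real p \<le> y},
      {n \<in> {1..N}. \<exists>m. y < real m \<and> m * m dvd n + 0},
      {n \<in> {1..N}. \<exists>p. prime p \<and> y < real p \<and> p dvd n \<and> (\<forall>r. prime r \<and> r dvd p + 1 \<longrightarrow> real r \<le> L)},
      {n \<in> {1..N}. \<exists>m. z < real m \<and> m * m dvd n + h},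
      {n \<in> {1..N}. \<exists>r q. L < real r \<and> r dvd q + 1 \<and> q dvd n + h \<and> r dvd n + h},
      {n \<in> {1..N}. \<exists>r p q. L < real r \<and> prime p \<and> prime q \<and> p \<noteq> q \<and> r dvd p + 1 \<and> r dvd q + 1
        \<and> p dvd n \<and> q dvd n + h \<and> real p * real q \<le> real N * sqrt (real r)},
      {n \<in> {1..N}. \<exists>r a b p q. L < real r \<and> prime r \<and> n = a * p \<and> n + h = b * q \<and> r dvd p + 1 \<and> r dvd q + 1
        \<and> \<not> r dvd n + h \<and> a \<noteq> b + h \<and> real N * sqrt (real r) < real p * real q},
      {n \<in> {1..N}. \<exists>b p q. prime p \<and> prime q \<and> n = (b + h) * p \<and> n + h = b * q}]"
    have "{n \<in> {1..N}. sigma n dvd sigma (n + h)} \<subseteq> \<Union>(set E)"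
    proof
      fix n assume "n \<in> {n \<in> {1..N}. sigma n dvd sigma (n + h)}"
      then have n: "n \<in> {1..N}" "sigma n dvd sigma (n + h)" by simp_all
      \<comment> \<open>Stated for abstract predicates, so that automation does not take the eight
        conditions apart.\<close>
      have split: "n \<in> \<Union>(set [{n \<in> {1..N}. P1 n}, {n \<in> {1..N}. P2 n}, {n \<in> {1..N}. P3 n}, {n \<in> {1..N}. P4 n},
        {n \<in> {1..N}. P5 n}, {n \<in> {1..N}. P6 n}, {n \<in> {1..N}. P7 n}, {n \<in> {1..N}. P8 n}])"
        if "P1 n \<or> P2 n \<or> P3 n \<or> P4 n \<or> P5 n \<or> P6 n \<or> P7 n \<or> P8 n" for P1 P2 P3 P4 P5 P6 P7 P8
        using that n(1) by auto
      show "n \<in> \<Union>(set E)" unfolding E_def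
        by (rule split) (rule sigma_dvd_shift_cases[OF n h L(1) L2(4) z])
    qed
    then have "card {n \<in> {1..N}. sigma n dvd sigma (n + h)} \<le> card (\<Union>(set E))"
      by (intro card_mono) (auto simp: E_def)
    also have "card (\<Union>(set E)) \<le> sum_list (map card E)"
    proof -
      have "card (\<Union>(set xs)) \<le> sum_list (map card xs)" for xs :: "nat set list"
        by (induction xs) (auto intro: order_trans[OF card_Un_le])
      then show ?thesis .
    qed
    finally have "real (card {n \<in> {1..N}. sigma n dvd sigma (n + h)}) \<le> sum_list (map (\<lambda>A. real (card A)) E)"
      unfolding E_def by simp
    then show ?thesis
      using card_smooth_le[OF N0 y, of N] card_large_square_divisor_le[of y 0 N]
        card_smooth_shifted_prime_le[OF y(1) L2(2) L(3), of N] card_large_square_divisor_le[OF z N]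
        card_dvd_shift_class_le[OF L2(1) N] card_two_large_primes_le[OF L2(1) N]
        card_nondegenerate_le[OF L2(1) L2(3) N h] C(2)[of N U M] N U M y(1)
      unfolding E_def list.map sum_list.Cons sum_list.Nil by linarith
  qed
  then show ?thesis using C(1) by blast
qed

lemma card_sigma_dvd_shift_asymp:
  fixes h :: nat
  assumes h: "h > 0"
  shows "\<exists>K N0. \<forall>N \<ge> N0. real (card {n \<in> {1..N}. sigma n dvd sigma (n + h)}) \<le> K * (real N / (ln (real N))\<^sup>2)"
proof -
  obtain C where C: "C \<ge> 0" and bound: "\<And>N U M (y::real) (z::real) (L::real). h \<le> N \<and> 2 \<le> U \<and> 1 \<le> M \<and> 1 < y \<and> 2 \<le> ln y
      \<and> 1 \<le> z \<and> L = 2 * z ^ 3 \<and> 2 * real h + 2 \<le> L \<and> 2 \<le> ln L \<longrightarrow>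
    real (card {n \<in> {1..N}. sigma n dvd sigma (n + h)}) \<le>
      (sqrt (real N) + real N * exp (- ln (sqrt (real N)) / ln y + 12 * ln y))
      + 6 * real N / sqrt y + 4 * real N * exp (- ln y / ln L + 12 * ln L)
      + 6 * real N / sqrt z + 12 * real N * harm (2 * N) / sqrt L
      + 24 * real N * (harm (2 * N))\<^sup>2 / sqrt L + 27 * real h * real N * (harm (2 * N))\<^sup>2 / sqrt L
      + (C * (real N / (ln (real U))\<^sup>2) + real M * (real U ^ 12 + real U + 1) + C * (real N / sqrt (real M)))"
    using card_sigma_dvd_shift_le[OF h] by blast
  let ?g = "\<lambda>x::real. x / (ln x)\<^sup>2"
  \<comment> \<open>This is ln y. The term \<open>F1\<close> needs it well below sqrt (ln x), while
    \<open>F3\<close> needs it well above the square of ln (ln x); the exponent 1/3 meets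
    both.\<close>
  define Y where "Y = (\<lambda>x::real. ln x powr (1 / 3))"
  \<comment> \<open>With z = (ln x)^4 the term \<open>F4\<close> is exactly of the target order.
    Then L = 2 z^3 has square root of order (ln x)^6, enough to absorb the two logarithms in
    \<open>F6\<close> and still save (ln x)^4.\<close>
  define \<Lambda> where "\<Lambda> = (\<lambda>x::real. 2 * ((ln x) ^ 4) ^ 3)"
  define F1 where "F1 = (\<lambda>x. sqrt x + x * exp (- ln (sqrt x) / Y x + 12 * Y x))"
  define F2 where "F2 = (\<lambda>x. 6 * x / sqrt (exp (Y x)))"
  define F3 where "F3 = (\<lambda>x. 4 * x * exp (- Y x / ln (\<Lambda> x) + 12 * ln (\<Lambda> x)))"
  define F4 where "F4 = (\<lambda>x::real. 6 * x / sqrt ((ln x) ^ 4))"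
  define F5 where "F5 = (\<lambda>x. 12 * x * (1 + ln (2 * x)) / sqrt (\<Lambda> x))"
  define F6 where "F6 = (\<lambda>x. x * (1 + ln (2 * x))\<^sup>2 / sqrt (\<Lambda> x))"
  define F7 where "F7 = (\<lambda>x::real. ((ln x) ^ 4 + 1) * (3 * sqrt x))"
  \<comment> \<open>The constant 626 is 25^2 + 1: the square comes from ln U \<ge> ln x / 25, the 1
    from the degenerate n with b > M.\<close>
  define F where "F = (\<lambda>x. F1 x + F2 x + F3 x + F4 x + F5 x + (24 + 27 * real h) * F6 x
    + (626 * C * ?g x + F7 x))"
  have "F1 \<in> O(?g)" unfolding F1_def Y_def by real_asymp
  moreover have "F2 \<in> O(?g)" unfolding F2_def Y_def by real_asymp
  moreover have "F3 \<in> O(?g)" unfolding F3_def Y_def \<Lambda>_def by real_asymp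
  moreover have "F4 \<in> O(?g)" unfolding F4_def by real_asymp
  moreover have "F5 \<in> O(?g)" unfolding F5_def \<Lambda>_def by real_asymp
  moreover have "F6 \<in> O(?g)" unfolding F6_def \<Lambda>_def by real_asymp
  moreover have "F7 \<in> O(?g)" unfolding F7_def by real_asymp
  moreover have "(\<lambda>x. c * G x) \<in> O(?g)" if "G \<in> O(?g)" for c and G :: "real \<Rightarrow> real"
    using that by (cases "c = 0") auto
  ultimately have "F \<in> O(?g)"
    unfolding F_def by (intro sum_in_bigo) (blast intro: landau_o.big_refl)+
  then obtain K where K: "\<forall>\<^sub>F x in at_top. norm (F x) \<le> K * norm (?g x)" by (auto elim: landau_o.bigE)
  have "\<forall>\<^sub>F x in at_top. norm (F x) \<le> K * norm (?g x) \<and> 8 \<le> Y x \<and> 1 \<le> (ln x) ^ 4 \<and> 2 * real h + 2 \<le> \<Lambda> x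
      \<and> 2 \<le> ln (\<Lambda> x) \<and> 2 \<le> x powr (1 / 25) \<and> x powr (1 / 25) \<le> x powr (1 / 24) - 1 \<and> 1 < x \<and> real h \<le> x"
    unfolding Y_def \<Lambda>_def by (intro eventually_conj K eventually_ge_at_top) real_asymp+
  then obtain x0 where x0: "\<And>x. x \<ge> x0 \<Longrightarrow> norm (F x) \<le> K * norm (?g x) \<and> 8 \<le> Y x \<and> 1 \<le> (ln x) ^ 4
      \<and> 2 * real h + 2 \<le> \<Lambda> x \<and> 2 \<le> ln (\<Lambda> x) \<and> 2 \<le> x powr (1 / 25) \<and> x powr (1 / 25) \<le> x powr (1 / 24) - 1
      \<and> 1 < x \<and> real h \<le> x"
    unfolding eventually_at_top_linorder by blast
  have "real (card {n \<in> {1..N}. sigma n dvd sigma (n + h)}) \<le> K * (real N / (ln (real N))\<^sup>2)"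
    if N: "N \<ge> nat \<lceil>x0\<rceil>" for N
  proof -
    define x where "x = real N"
    have "x \<ge> x0" using N unfolding x_def by linarith
    note x = x0[OF this]
    have x1: "x > 1" "ln x > 0" and hN: "h \<le> N" using x by (auto simp: x_def)
    \<comment> \<open>The exponent 1/24 makes U^12 at most sqrt x; rounding down is absorbed by the
      weaker lower bound x powr (1 / 25). The choice of M as (ln x)^4 makes sqrt M at least (ln x)^2
      and keeps M U^12 negligible.\<close>
    define U where "U = nat \<lfloor>x powr (1 / 24)\<rfloor>"
    define M where "M = nat \<lceil>(ln x) ^ 4\<rceil>"
    have U: "real U \<le> x powr (1 / 24)" "x powr (1 / 24) < real U + 1"
      using x1 by (auto simp: U_def of_nat_nat)
    have U25: "x powr (1 / 25) \<le> real U" "2 \<le> real U" using U x by linarith+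
    have M: "(ln x) ^ 4 \<le> real M" "real M \<le> (ln x) ^ 4 + 1" "1 \<le> M"
      using x by (auto simp: M_def) linarith+
    have lnU: "ln x / 25 \<le> ln (real U)"
      using ln_mono[of "x powr (1 / 25)" "real U"] U25 x1 by (simp add: ln_powr)
    have U12: "real U ^ 12 \<le> sqrt x"
    proof -
      have "real U ^ 12 \<le> (x powr (1 / 24)) ^ 12" using U by (intro power_mono) auto
      also have "\<dots> = x powr (1 / 2)" using x1 by (simp add: powr_power)
      also have "\<dots> = sqrt x" using x1 by (simp add: powr_half_sqrt)
      finally show ?thesis .
    qed
    have "real U \<le> real U ^ 12" using U25 by (intro self_le_power) auto
    then have e: "real U ^ 12 + real U + 1 \<le> 3 * sqrt x" using U12 U25 by linarith
    have H: "harm (2 * N) \<le> 1 + ln (2 * x)" using harm_le_ln[of "2 * N"] hN h by (simp add: x_def)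
    have H0: "(0::real) \<le> harm (2 * N)" by (rule harm_nonneg)
    have H2: "(harm (2 * N))\<^sup>2 \<le> (1 + ln (2 * x))\<^sup>2" using H H0 by (intro power_mono)
    have sL: "sqrt (\<Lambda> x) > 0" using x by simp
    have "real (card {n \<in> {1..N}. sigma n dvd sigma (n + h)}) \<le>
      F1 x + F2 x + F3 x + F4 x + 12 * x * harm (2 * N) / sqrt (\<Lambda> x)
      + 24 * x * (harm (2 * N))\<^sup>2 / sqrt (\<Lambda> x) + 27 * real h * x * (harm (2 * N))\<^sup>2 / sqrt (\<Lambda> x)
      + (C * (x / (ln (real U))\<^sup>2) + real M * (real U ^ 12 + real U + 1) + C * (x / sqrt (real M)))"
      using bound[of N U M "exp (Y x)" "(ln x) ^ 4" "\<Lambda> x"] x hN U25 M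
      unfolding F1_def F2_def F3_def F4_def x_def[symmetric] by (simp add: \<Lambda>_def)
    also have "12 * x * harm (2 * N) / sqrt (\<Lambda> x) \<le> F5 x"
      unfolding F5_def using H x1 sL by (intro divide_right_mono mult_left_mono) auto
    also have "24 * x * (harm (2 * N))\<^sup>2 / sqrt (\<Lambda> x) \<le> 24 * F6 x"
      unfolding F6_def using mult_left_mono[OF H2, of "24 * x"] x1 sL by (simp add: divide_right_mono)
    also have "27 * real h * x * (harm (2 * N))\<^sup>2 / sqrt (\<Lambda> x) \<le> 27 * real h * F6 x"
      unfolding F6_def using mult_left_mono[OF H2, of "27 * real h * x"] x1 sL
      by (simp add: divide_right_mono mult.assoc)
    also have "C * (x / (ln (real U))\<^sup>2) \<le> C * (625 * ?g x)"
    proof (rule mult_left_mono[OF _ C])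
      have "(ln x / 25)\<^sup>2 \<le> (ln (real U))\<^sup>2" using lnU x1 by (intro power_mono) auto
      then have "x / (ln (real U))\<^sup>2 \<le> x / (ln x / 25)\<^sup>2"
        using x1 by (intro frac_le) auto
      then show "x / (ln (real U))\<^sup>2 \<le> 625 * ?g x" by (simp add: power_divide mult.commute)
    qed
    also have "real M * (real U ^ 12 + real U + 1) \<le> F7 x"
      unfolding F7_def using M e x1 by (intro mult_mono) auto
    also have "C * (x / sqrt (real M)) \<le> C * ?g x"
    proof (rule mult_left_mono[OF _ C])
      have "sqrt ((ln x) ^ 4) \<le> sqrt (real M)" using M by simp
      moreover have "sqrt ((ln x) ^ 4) = (ln x)\<^sup>2" by (rule real_sqrt_unique) auto
      ultimately show "x / sqrt (real M) \<le> ?g x" using x1 M by (intro divide_left_mono) auto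
    qed
    finally have "real (card {n \<in> {1..N}. sigma n dvd sigma (n + h)}) \<le> F x"
      unfolding F_def by (simp add: algebra_simps)
    also have "\<dots> \<le> K * norm (?g x)" using x by auto
    also have "norm (?g x) = ?g x" using x1 by simp
    finally show ?thesis by (simp add: x_def)
  qed
  then show ?thesis by blast
qed

theorem corollary3p7:
  fixes h :: nat
  assumes "h \<ge> 1"
  shows "(\<lambda>x :: real. real (B h x)) \<in> O[at_top](\<lambda>x. x / (ln x)\<^sup>2)"
proof -
  obtain K N0 where K: "\<And>N. N \<ge> N0 \<Longrightarrow>
      real (card {n \<in> {1..N}. sigma n dvd sigma (n + h)}) \<le> K * (real N / (ln (real N))\<^sup>2)"
    using card_sigma_dvd_shift_asymp[of h] assms by auto
  show ?thesis
  proof (rule bigoI[where c = "4 * \<bar>K\<bar>"])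
    \<comment> \<open>Replacing x by its integer part N: since sqrt x \<le> x - 1 < N, ln N \<ge> ln
      x / 2, which costs the factor 4.\<close>
    have "\<forall>\<^sub>F x::real in at_top. sqrt x \<le> x - 1" by real_asymp
    then show "\<forall>\<^sub>F x in at_top. norm (real (B h x)) \<le> 4 * \<bar>K\<bar> * norm (x / (ln x)\<^sup>2)"
      using eventually_ge_at_top[of "real N0 + 4"]
    proof eventually_elim
      case (elim x)
      define N where "N = nat \<lfloor>x\<rfloor>"
      have x: "x \<ge> 4" "sqrt x \<le> x - 1" using elim by auto
      have N: "real N \<le> x" "x < real N + 1" using x by (auto simp: N_def of_nat_nat)
      then have "N \<ge> N0" using elim by linarith
      have "{n. 1 \<le> n \<and> real n \<le> x \<and> sigma n dvd sigma (n + h)} = {n \<in> {1..N}. sigma n dvd sigma (n + h)}"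
        using x by (auto simp: N_def le_nat_floor le_nat_iff le_floor_iff)
      then have "real (B h x) \<le> K * (real N / (ln (real N))\<^sup>2)"
        unfolding B_def using K[OF \<open>N \<ge> N0\<close>] by simp
      also have "\<dots> \<le> \<bar>K\<bar> * (real N / (ln (real N))\<^sup>2)" by (intro mult_right_mono) auto
      also have "\<dots> \<le> \<bar>K\<bar> * (x / (ln x / 2)\<^sup>2)"
      proof (intro mult_left_mono frac_le power_mono)
        have "ln (sqrt x) \<le> ln (real N)" using N x by (intro ln_mono) auto
        then show "ln x / 2 \<le> ln (real N)" using x by (simp add: ln_sqrt)
      qed (use N x in auto)
      finally show "norm (real (B h x)) \<le> 4 * \<bar>K\<bar> * norm (x / (ln x)\<^sup>2)"
        using x by (simp add: power_divide mult_ac)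
    qed
  qed
qed

end
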